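(* Let $\Omega$ be the $D_\infty$ mountain quiver. Then the relation $\le$ on the set $\mathrm{indec}_{\mathrm{FLEI}}(\Omega)$ of isomorphism classes of indecomposable FLEI representations of $\Omega$ is a well-founded partial order.
   Context: The $D_\infty$ mountain quiver has vertices $u,u',v_1,v_2,v_3,\dots$ and arrows $v_1\to u$, $v_1\to u'$, and $v_j\to v_{j+1}$ for all $j\ge1$ (all arrows point away from the trivalent vertex $v_1$). A representation $V$ (over a fixed field) assigns to each vertex $i$ a vector space $V(i)$ and to each arrow $a:i\to j$ a linear map $V(a):V(i)\to V(j)$. $V$ is FLEI if every $V(i)$ is finite-dimensional and $V(a)$ is an isomorphism for all but finitely many arrows $a$. Relation: $\alpha\ge\beta$ (equivalently $\beta\le\alpha$) iff there are $\alpha=\gamma_1,\gamma_2,\dots,\gamma_n=\beta$ in $\mathrm{indec}_{\mathrm{FLEI}}(\Omega)$ (with $n\ge1$), representatives $W^{\gamma_i}\in\gamma_i$, and morphisms $W^{\gamma_1}\to W^{\gamma_2}\to\cdots\to W^{\gamma_n}$ each of which is nonzero and not an isomorphism. *)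

theory Defs
  imports "Graph_Theory.Digraph"
begin

text \<open>
  A quiver is a digraph in the sense of the record \<open>pre_digraph\<close>. A representation assigns to each
  vertex a subspace of an ambient vector space \<open>'v\<close> over the field \<open>'k\<close>. The ambient space is
  arbitrary and only plays the role of a universe: once it is infinite-dimensional, every family of
  finite-dimensional spaces is realised in it up to isomorphism. The values of \<open>vspace\<close> outside
  \<open>verts Q\<close>, of \<open>vmap\<close> outside \<open>arcs Q\<close>, and of a linear map outside its domain are irrelevant.
\<close>

record ('a, 'b, 'v) rep =
  vspace :: "'a \<Rightarrow> 'v set"
  vmap :: "'b \<Rightarrow> 'v \<Rightarrow> 'v"

definition linear_between ::
  "('k::field \<Rightarrow> 'v::ab_group_add \<Rightarrow> 'v) \<Rightarrow> 'v set \<Rightarrow> 'v set \<Rightarrow> ('v \<Rightarrow> 'v) \<Rightarrow> bool" where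
  "linear_between s S T f \<longleftrightarrow>
     f ` S \<subseteq> T \<and>
     (\<forall>x\<in>S. \<forall>y\<in>S. f (x + y) = f x + f y) \<and>
     (\<forall>c. \<forall>x\<in>S. f (s c x) = s c (f x))"

definition quiver_rep ::
  "('k::field \<Rightarrow> 'v::ab_group_add \<Rightarrow> 'v) \<Rightarrow>
   ('q, 'e) pre_digraph \<Rightarrow> ('q, 'e, 'v) rep \<Rightarrow> bool" where
  "quiver_rep s Q V \<longleftrightarrow>
     (\<forall>i\<in>verts Q. module.subspace s (vspace V i)) \<and>
     (\<forall>a\<in>arcs Q. linear_between s (vspace V (tail Q a)) (vspace V (head Q a)) (vmap V a))"

definition flei ::
  "('k::field \<Rightarrow> 'v::ab_group_add \<Rightarrow> 'v) \<Rightarrow>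
   ('q, 'e) pre_digraph \<Rightarrow> ('q, 'e, 'v) rep \<Rightarrow> bool" where
  "flei s Q V \<longleftrightarrow>
     (\<forall>i\<in>verts Q. \<exists>B. finite B \<and> module.span s B = vspace V i) \<and>
     finite {a \<in> arcs Q. \<not> bij_betw (vmap V a) (vspace V (tail Q a)) (vspace V (head Q a))}"

definition zero_rep :: "('q, 'e) pre_digraph \<Rightarrow> ('q, 'e, 'v::zero) rep \<Rightarrow> bool" where
  "zero_rep Q V \<longleftrightarrow> (\<forall>i\<in>verts Q. vspace V i = {0})"

definition subrep ::
  "('k::field \<Rightarrow> 'v::ab_group_add \<Rightarrow> 'v) \<Rightarrow>
   ('q, 'e) pre_digraph \<Rightarrow>
   ('q, 'e, 'v) rep \<Rightarrow> ('q, 'e, 'v) rep \<Rightarrow> bool" where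
  "subrep s Q X V \<longleftrightarrow>
     quiver_rep s Q X \<and>
     (\<forall>i\<in>verts Q. vspace X i \<subseteq> vspace V i) \<and>
     (\<forall>a\<in>arcs Q. \<forall>x\<in>vspace X (tail Q a). vmap X a x = vmap V a x)"

definition direct_sum_of ::
  "('k::field \<Rightarrow> 'v::ab_group_add \<Rightarrow> 'v) \<Rightarrow>
   ('q, 'e) pre_digraph \<Rightarrow>
   ('q, 'e, 'v) rep \<Rightarrow> ('q, 'e, 'v) rep \<Rightarrow> ('q, 'e, 'v) rep \<Rightarrow> bool" where
  "direct_sum_of s Q V X Y \<longleftrightarrow>
     subrep s Q X V \<and> subrep s Q Y V \<and>
     (\<forall>i\<in>verts Q. vspace X i \<inter> vspace Y i = {0} \<and>
        vspace V i = {x + y |x y. x \<in> vspace X i \<and> y \<in> vspace Y i})"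

definition indecomposable ::
  "('k::field \<Rightarrow> 'v::ab_group_add \<Rightarrow> 'v) \<Rightarrow>
   ('q, 'e) pre_digraph \<Rightarrow> ('q, 'e, 'v) rep \<Rightarrow> bool" where
  "indecomposable s Q V \<longleftrightarrow>
     \<not> zero_rep Q V \<and>
     (\<forall>X Y. direct_sum_of s Q V X Y \<longrightarrow> zero_rep Q X \<or> zero_rep Q Y)"

definition morphism ::
  "('k::field \<Rightarrow> 'v::ab_group_add \<Rightarrow> 'v) \<Rightarrow>
   ('q, 'e) pre_digraph \<Rightarrow>
   ('q, 'e, 'v) rep \<Rightarrow> ('q, 'e, 'v) rep \<Rightarrow> ('q \<Rightarrow> 'v \<Rightarrow> 'v) \<Rightarrow> bool" where
  "morphism s Q V W f \<longleftrightarrow>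
     (\<forall>i\<in>verts Q. linear_between s (vspace V i) (vspace W i) (f i)) \<and>
     (\<forall>a\<in>arcs Q. \<forall>x\<in>vspace V (tail Q a).
        f (head Q a) (vmap V a x) = vmap W a (f (tail Q a) x))"

definition isomorphism ::
  "('k::field \<Rightarrow> 'v::ab_group_add \<Rightarrow> 'v) \<Rightarrow>
   ('q, 'e) pre_digraph \<Rightarrow>
   ('q, 'e, 'v) rep \<Rightarrow> ('q, 'e, 'v) rep \<Rightarrow> ('q \<Rightarrow> 'v \<Rightarrow> 'v) \<Rightarrow> bool" where
  "isomorphism s Q V W f \<longleftrightarrow>
     morphism s Q V W f \<and> (\<forall>i\<in>verts Q. bij_betw (f i) (vspace V i) (vspace W i))"

definition nonzero_morphism ::
  "('k::field \<Rightarrow> 'v::ab_group_add \<Rightarrow> 'v) \<Rightarrow>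
   ('q, 'e) pre_digraph \<Rightarrow>
   ('q, 'e, 'v) rep \<Rightarrow> ('q, 'e, 'v) rep \<Rightarrow> ('q \<Rightarrow> 'v \<Rightarrow> 'v) \<Rightarrow> bool" where
  "nonzero_morphism s Q V W f \<longleftrightarrow>
     morphism s Q V W f \<and> (\<exists>i\<in>verts Q. \<exists>x\<in>vspace V i. f i x \<noteq> 0)"

definition flei_indecomposables ::
  "('k::field \<Rightarrow> 'v::ab_group_add \<Rightarrow> 'v) \<Rightarrow>
   ('q, 'e) pre_digraph \<Rightarrow> ('q, 'e, 'v) rep set" where
  "flei_indecomposables s Q = {V. quiver_rep s Q V \<and> flei s Q V \<and> indecomposable s Q V}"

definition iso_rel ::
  "('k::field \<Rightarrow> 'v::ab_group_add \<Rightarrow> 'v) \<Rightarrow>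
   ('q, 'e) pre_digraph \<Rightarrow> ('q, 'e, 'v) rep rel" where
  "iso_rel s Q = {(V, W). V \<in> flei_indecomposables s Q \<and> W \<in> flei_indecomposables s Q \<and>
     (\<exists>f. isomorphism s Q V W f)}"

definition indec_flei ::
  "('k::field \<Rightarrow> 'v::ab_group_add \<Rightarrow> 'v) \<Rightarrow>
   ('q, 'e) pre_digraph \<Rightarrow> ('q, 'e, 'v) rep set set" where
  "indec_flei s Q = flei_indecomposables s Q // iso_rel s Q"

definition indec_le ::
  "('k::field \<Rightarrow> 'v::ab_group_add \<Rightarrow> 'v) \<Rightarrow>
   ('q, 'e) pre_digraph \<Rightarrow> ('q, 'e, 'v) rep set \<Rightarrow> ('q, 'e, 'v) rep set \<Rightarrow> bool" where
  "indec_le s Q \<beta> \<alpha> \<longleftrightarrow>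
     (\<exists>(n::nat) \<gamma> W f. n \<ge> 1 \<and> \<gamma> 1 = \<alpha> \<and> \<gamma> n = \<beta> \<and>
        (\<forall>i\<in>{1..n}. \<gamma> i \<in> indec_flei s Q \<and> W i \<in> \<gamma> i) \<and>
        (\<forall>i\<in>{1..<n}. nonzero_morphism s Q (W i) (W (Suc i)) (f i) \<and>
           \<not> isomorphism s Q (W i) (W (Suc i)) (f i)))"

text \<open>The constructor term \<open>Vn j\<close> stands for the vertex \<open>v\<^sub>j\<^sub>+\<^sub>1\<close>, so \<open>Vn 0\<close> is the trivalent vertex.\<close>

datatype mountain_vertex = Vu | Vu' | Vn nat

definition D_inf_mountain ::
  "(mountain_vertex, mountain_vertex \<times> mountain_vertex) pre_digraph" where
  "D_inf_mountain =
     \<lparr>verts = UNIV,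
      arcs = {(Vn 0, Vu), (Vn 0, Vu')} \<union> {(Vn j, Vn (Suc j)) |j. True},
      tail = fst,
      head = snd\<rparr>"

end

theory Submission
  imports Defs "HOL-Library.Extended_Nat"
begin

text \<open>
Write \<open>U\<close> for the space of a representation at a vertex \<open>v\<close> and suppose that all arrows lying
behind \<open>v\<close> are onto. Then the part of the representation behind \<open>v\<close> is determined by \<open>U\<close> and by
the kernels of the composite maps out of \<open>v\<close>: two subspaces \<open>A\<close> and \<open>B\<close> for the leaves \<open>u\<close> and
\<open>u'\<close>, and an increasing chain \<open>K\<^sub>0 \<subseteq> K\<^sub>1 \<subseteq> \<dots>\<close> along the infinite leg. An idempotent endomorphism of
an indecomposable representation is \<open>0\<close> or the identity, because its image and its kernel are
complementary subrepresentations; and an idempotent of \<open>U\<close> that preserves \<open>A\<close>, \<open>B\<close> and all \<open>K\<^sub>k\<close>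
and kills what arrives at \<open>v\<close> from an earlier vertex extends to the whole representation. Splitting
a suitable line or plane off \<open>U\<close> therefore gives the list of indecomposables (lemmas
\<open>thin_or_planar\<close> and \<open>indecomposable_cases\<close>), which mirrors the positive roots of \<open>D\<^sub>\<infinity>\<close>. Either the representation is one-dimensional and concentrated at \<open>u\<close> or
\<open>u'\<close>. Or there is a vertex on the leg before which it vanishes and from which it is generated, and
\<open>U\<close> at that vertex is a line, or a plane with basis \<open>a, b\<close> such that \<open>A = \<langle>a\<rangle>\<close>, \<open>B = \<langle>b\<rangle>\<close> and every
\<open>K\<^sub>k\<close> is one of \<open>0\<close>, \<open>\<langle>a + b\<rangle>\<close>, \<open>U\<close>, where \<open>\<langle>a + b\<rangle>\<close> does occur. Away from the trivalent
vertex \<open>U\<close> is a line, and \<open>A = B = U\<close> by convention. The generating vertex is the end of the last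
arrow of the leg that is not onto, or the trivalent vertex if all of them are; there is a last one
because almost all arrows are isomorphisms.

To each of these representations belongs a quadruple \<open>(s, r, p, q)\<close>: \<open>s\<close> is the generating vertex
(\<open>\<infinity>\<close> for the two simples at the leaves), \<open>r\<close> is \<open>2\<close> if \<open>A = B = 0\<close>, \<open>0\<close> if \<open>A = B = U\<close> and \<open>1\<close>
otherwise, and \<open>p\<close> and \<open>q\<close> are the first indices at which the chain \<open>K\<close> becomes nonzero and equal
to \<open>U\<close>. A nonzero morphism never increases this quadruple lexicographically, and if it preserves
the quadruple then it is an isomorphism (lemmas \<open>data_measure_decreases\<close> and
\<open>rep_measure_decreases\<close>). All entries lie in well-ordered sets, so there is no infinite chain of
nonzero non-isomorphisms between indecomposables, not even one in which the composites vanish.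

The relation \<open>\<le>\<close> is the reflexive transitive closure of the one-step relation that such morphisms
induce on isomorphism classes (lemma \<open>indec_le_iff\<close>). Since the one-step relation is well-founded,
it has no cycles, which is antisymmetry, and its transitive closure is well-founded, which is the
second claim.
\<close>

section \<open>Lines and planes that split off a kernel configuration\<close>

text \<open>
A configuration \<open>(U, A, B, K)\<close>: \<open>kerl\<close> and \<open>kerr\<close> stand for the kernels of the maps to the two
leaves, and \<open>kerleg k\<close> for the kernel of the \<open>k\<close>-fold composite along the leg.
\<close>
record 'v kernel_data =
  space :: "'v set"
  kerl :: "'v set"
  kerr :: "'v set"
  kerleg :: "nat \<Rightarrow> 'v set"

text \<open>
A copy of \<open>vector_space\<close> under its own name: definitions made inside \<open>vector_space\<close> itself would also
be instantiated for real vector spaces, and the two versions of each constant would share a name.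
\<close>
locale scaled_space = vector_space scale
  for scale :: "'k::field \<Rightarrow> 'v::ab_group_add \<Rightarrow> 'v" (infixr \<open>*s\<close> 75)
begin

lemma separating_functional:
  assumes "subspace S" "x \<notin> S"
  obtains \<phi> :: "'v \<Rightarrow> 'k" where
    "\<And>y z. \<phi> (y + z) = \<phi> y + \<phi> z" "\<And>c y. \<phi> (c *s y) = c * \<phi> y"
    "\<And>y. y \<in> S \<Longrightarrow> \<phi> y = 0" "\<phi> x = 1"
proof -
  interpret F: vector_space "(*) :: 'k \<Rightarrow> 'k \<Rightarrow> 'k"
    by unfold_locales (auto simp: algebra_simps)
  interpret P: vector_space_pair scale "(*) :: 'k \<Rightarrow> 'k \<Rightarrow> 'k" ..
  obtain B where B: "B \<subseteq> S" "independent B" "S \<subseteq> span B"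
    using maximal_independent_subset by blast
  then have "span B = S"
    using assms(1) by (simp add: span_minimal subset_antisym)
  then have "independent (insert x B)" and "x \<notin> B"
    using assms(2) B independent_insertI by auto
  then obtain g where g: "Vector_Spaces.linear scale (*) g"
      "\<forall>y\<in>insert x B. g y = (if y = x then 1 else 0)"
    using P.linear_independent_extend[of "insert x B" "\<lambda>y. if y = x then 1 else 0"] by blast
  have "g y = 0" if "y \<in> S" for y
  proof (rule P.linear_eq_0_on_span[OF g(1)])
    show "g z = 0" if "z \<in> B" for z using that g(2) \<open>x \<notin> B\<close> by auto
    show "y \<in> span B" using that \<open>span B = S\<close> by simp
  qed
  with g that[of g] show thesis
    by (auto simp: P.linear_add P.linear_scale)
qed

lemma subspace_of_line:
  assumes "subspace S" "S \<subseteq> span {x}"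
  shows "S = {0} \<or> S = span {x}"
proof (cases "S = {0}")
  case False
  then obtain y where y: "y \<in> S" "y \<noteq> 0"
    using assms(1) subspace_0 by blast
  then obtain c where c: "y = c *s x"
    using assms(2) by (auto simp: span_singleton)
  with y have "x = inverse c *s y" by auto
  then have "x \<in> S"
    using y assms(1) by (simp add: subspace_scale)
  then have "span {x} \<subseteq> S"
    using assms(1) by (simp add: span_minimal)
  with assms(2) show ?thesis by blast
qed simp

lemma span_scaled: "c \<noteq> 0 \<Longrightarrow> span {c *s x} = span {x}"
proof -
  assume "c \<noteq> 0"
  then have "x = inverse c *s (c *s x)" by simp
  then have "x \<in> span {c *s x}" by (metis rangeI span_singleton)
  moreover have "c *s x \<in> span {x}" by (auto simp: span_singleton)
  ultimately show ?thesis by (simp add: span_minimal subset_antisym)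
qed

text \<open>
The source of all idempotents that split off a line: \<open>e\<close> projects onto \<open>\<langle>x\<rangle>\<close> along a hyperplane
through \<open>S\<close>. It preserves each subspace that contains \<open>x\<close> or lies in \<open>S\<close>.
\<close>
lemma rank_one_projection:
  assumes S: "subspace S" and U: "subspace U" and x: "x \<in> U" "x \<notin> S"
  obtains e where "linear_between scale U U e" "\<And>y. y \<in> S \<Longrightarrow> e y = 0" "\<And>y. e (e y) = e y"
    "e x = x" "\<And>y. e y \<in> span {x}"
proof -
  obtain \<phi> where \<phi>: "\<And>y z. \<phi> (y + z) = \<phi> y + \<phi> z" "\<And>c y. \<phi> (c *s y) = c * \<phi> y"
    "\<And>y. y \<in> S \<Longrightarrow> \<phi> y = 0" "\<phi> x = 1"
    using separating_functional[OF S x(2)] by blast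
  show thesis
  proof (rule that[of "\<lambda>y. \<phi> y *s x"])
    show "linear_between scale U U (\<lambda>y. \<phi> y *s x)"
      using U x by (auto simp: linear_between_def \<phi> subspace_scale scale_left_distrib)
    show "\<phi> y *s x \<in> span {x}" for y by (auto simp: span_singleton)
  qed (simp_all add: \<phi>)
qed

definition kernel_data_wf :: "'v kernel_data \<Rightarrow> bool" where
  "kernel_data_wf D \<longleftrightarrow> subspace (space D) \<and>
     subspace (kerl D) \<and> kerl D \<subseteq> space D \<and> subspace (kerr D) \<and> kerr D \<subseteq> space D \<and>
     (\<forall>k. subspace (kerleg D k) \<and> kerleg D k \<subseteq> space D) \<and>
     kerleg D 0 = {0} \<and> mono (kerleg D)"

definition data_map :: "'v kernel_data \<Rightarrow> 'v kernel_data \<Rightarrow> ('v \<Rightarrow> 'v) \<Rightarrow> bool" where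
  "data_map D D' f \<longleftrightarrow> linear_between scale (space D) (space D') f \<and>
     f ` kerl D \<subseteq> kerl D' \<and> f ` kerr D \<subseteq> kerr D' \<and> (\<forall>k. f ` kerleg D k \<subseteq> kerleg D' k)"

definition data_iso :: "'v kernel_data \<Rightarrow> 'v kernel_data \<Rightarrow> ('v \<Rightarrow> 'v) \<Rightarrow> bool" where
  "data_iso D D' f \<longleftrightarrow> inj_on f (space D) \<and> f ` space D = space D' \<and> f ` kerl D = kerl D' \<and>
     f ` kerr D = kerr D' \<and> (\<forall>k. f ` kerleg D k = kerleg D' k)"

definition trivial_idempotents :: "'v kernel_data \<Rightarrow> bool" where
  "trivial_idempotents D \<longleftrightarrow>
     (\<forall>e. data_map D D e \<longrightarrow> (\<forall>y\<in>space D. e (e y) = e y) \<longrightarrow>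
        (\<forall>y\<in>space D. e y = 0) \<or> (\<forall>y\<in>space D. e y = y))"

definition thin :: "'v kernel_data \<Rightarrow> bool" where
  "thin D \<longleftrightarrow> (\<exists>x. x \<noteq> 0 \<and> space D = span {x})"

text \<open>
The configuration of three lines in a plane, \<open>\<langle>a\<rangle>\<close>, \<open>\<langle>b\<rangle>\<close> and \<open>\<langle>a + b\<rangle>\<close>, realised by the kernels
to the left leaf, to the right leaf and along the leg. The last conjunct is what makes it
indecomposable: if \<open>\<langle>a + b\<rangle>\<close> did not occur in the chain, the lines \<open>\<langle>a\<rangle>\<close> and \<open>\<langle>b\<rangle>\<close> would split.
\<close>
definition planar_basis :: "'v kernel_data \<Rightarrow> 'v \<Rightarrow> 'v \<Rightarrow> bool" where
  "planar_basis D a b \<longleftrightarrow> a \<noteq> 0 \<and> b \<noteq> 0 \<and> span {a} \<inter> span {b} = {0} \<and>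
     kerl D = span {a} \<and> kerr D = span {b} \<and> space D = span {a, b} \<and>
     (\<forall>k. kerleg D k \<in> {{0}, span {a + b}, space D}) \<and> (\<exists>k. kerleg D k = span {a + b})"

text \<open>
The hypotheses say that each of the kernels is zero, contains \<open>x\<close>, or lies in \<open>S\<close>. So the projection
onto \<open>\<langle>x\<rangle>\<close> along a hyperplane through \<open>S\<close> preserves all of them, and being nonzero it is the identity.
\<close>
lemma thin_if_line_splits:
  assumes wf: "kernel_data_wf D" and triv: "trivial_idempotents D"
    and x: "x \<in> space D" "x \<noteq> 0"
    and leg: "\<And>k. kerleg D k = {0} \<or> x \<in> kerleg D k"
    and S: "subspace S" "x \<notin> S"
    and l: "x \<in> kerl D \<or> kerl D \<subseteq> S" and r: "x \<in> kerr D \<or> kerr D \<subseteq> S"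
  shows "thin D"
proof -
  have space: "subspace (space D)" using wf by (simp add: kernel_data_wf_def)
  obtain e where e: "linear_between scale (space D) (space D) e" "\<And>y. y \<in> S \<Longrightarrow> e y = 0"
    "\<And>y. e (e y) = e y" "e x = x" "\<And>y. e y \<in> span {x}"
    using rank_one_projection[OF S(1) space x(1) S(2)] by blast
  have pres: "e ` T \<subseteq> T" if T: "subspace T" "T = {0} \<or> x \<in> T \<or> T \<subseteq> S" for T
  proof (cases "x \<in> T")
    case True
    then have "span {x} \<subseteq> T" using T(1) by (simp add: span_minimal)
    then show ?thesis using e(5) by blast
  next
    case False
    then have "T \<subseteq> S" using T(2) subspace_0[OF S(1)] by blast
    then show ?thesis using e(2) subspace_0[OF T(1)] by auto
  qed
  have "e ` kerl D \<subseteq> kerl D" "e ` kerr D \<subseteq> kerr D" "e ` kerleg D k \<subseteq> kerleg D k" for k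
    using wf leg[of k] l r by (intro pres; auto simp: kernel_data_wf_def)+
  then have "data_map D D e"
    unfolding data_map_def using e(1) by blast
  then have "\<forall>y\<in>space D. e y = y"
    using triv x e(3,4) unfolding trivial_idempotents_def by metis
  then have "space D \<subseteq> span {x}" using e(5) by (metis subsetI)
  then have "space D = span {x}"
    using x(1) space by (simp add: span_minimal subset_antisym)
  with x show ?thesis unfolding thin_def by blast
qed

text \<open>
Think of \<open>F\<close> as the first nonzero member of the chain and of \<open>L\<close> as the union of the members in
which \<open>a + b\<close> cannot be decomposed into a part in the left and a part in the right kernel; the last
hypothesis says that the chosen decomposition is available in all other members. Under these
conditions the plane \<open>\<langle>a, b\<rangle>\<close> splits off, by a projection \<open>y \<mapsto> \<alpha>(y) a + \<beta>(y) b\<close>. This projection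
preserves the left kernel if \<open>\<beta>\<close> vanishes on it, the right kernel if \<open>\<alpha>\<close> vanishes on it, and the
members of the chain inside \<open>L\<close> if \<open>\<alpha> = \<beta>\<close> on \<open>L\<close>.
\<close>
lemma planar_if_plane_splits:
  assumes wf: "kernel_data_wf D" and triv: "trivial_idempotents D"
    and a: "a \<in> kerl D" "a \<noteq> 0" and b: "b \<in> kerr D"
    and F: "subspace F" "a + b \<in> F" "F \<inter> kerl D \<subseteq> {0}" "F \<inter> kerr D \<subseteq> {0}" "F = kerleg D k0"
    and L: "subspace L" "F \<subseteq> L" "\<And>y. y \<in> L \<Longrightarrow> y \<in> kerl D \<Longrightarrow> a + b - y \<notin> kerr D"
    and leg: "\<And>k. kerleg D k = {0} \<or> F \<subseteq> kerleg D k"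
    and leg': "\<And>k. kerleg D k \<subseteq> L \<or> a \<in> kerleg D k"
  shows "planar_basis D a b"
proof -
  have sub: "subspace (space D)" "subspace (kerl D)" "subspace (kerr D)" "\<And>k. subspace (kerleg D k)"
    and in_space: "kerl D \<subseteq> space D" "kerr D \<subseteq> space D" "\<And>k. kerleg D k \<subseteq> space D"
    using wf by (auto simp: kernel_data_wf_def)
  \<comment> \<open>The difference \<open>\<gamma> = \<alpha> - \<beta>\<close> has to vanish on \<open>L\<close> and on the intersection of the two kernels.\<close>
  define S where "S = {y + z | y z. y \<in> L \<and> z \<in> kerl D \<inter> kerr D}"
  have S: "subspace S"
    unfolding S_def using L sub by (intro subspace_sums subspace_inter) auto
  have "a \<notin> S"
  proof
    assume "a \<in> S"
    then obtain y z where yz: "a = y + z" "y \<in> L" "z \<in> kerl D" "z \<in> kerr D"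
      by (auto simp: S_def)
    then have "y \<in> kerl D"
      using a sub by (metis add_diff_cancel_right' subspace_diff)
    moreover have "a + b - y \<in> kerr D"
      using yz b sub by (simp add: subspace_add)
    ultimately show False using L yz by blast
  qed
  obtain \<gamma> where \<gamma>: "\<And>y z. \<gamma> (y + z) = \<gamma> y + \<gamma> z" "\<And>c y. \<gamma> (c *s y) = c * \<gamma> y"
    "\<And>y. y \<in> S \<Longrightarrow> \<gamma> y = 0" "\<gamma> a = 1"
    using separating_functional[OF S \<open>a \<notin> S\<close>] by blast
  have \<gamma>0: "\<gamma> 0 = 0" using \<gamma>(2)[of 0 0] by simp
  have \<gamma>L: "\<gamma> y = 0" if "y \<in> L" for y
    using that sub subspace_0 \<gamma>(3)[of y] unfolding S_def
    by (metis (mono_tags, lifting) IntI add_0_right mem_Collect_eq)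
  have \<gamma>I: "\<gamma> y = 0" if "y \<in> kerl D" "y \<in> kerr D" for y
    using that L(1) subspace_0 \<gamma>(3)[of y] unfolding S_def
    by (metis (mono_tags, lifting) IntI add_0_left mem_Collect_eq)
  \<comment> \<open>Besides vanishing on the right kernel, \<open>\<alpha>\<close> has to agree with \<open>\<gamma>\<close> on the left kernel. The latter
    is \<open>\<langle>a\<rangle> \<oplus> C\<close>, so it suffices that \<open>\<alpha>\<close> vanishes on \<open>C\<close> and takes the value \<open>1\<close> at \<open>a\<close>.\<close>
  define C where "C = {y \<in> kerl D. \<gamma> y = 0}"
  have C: "subspace C"
    using sub(2) by (auto simp: C_def subspace_def \<gamma> \<gamma>0)
  define T where "T = {y + z | y z. y \<in> kerr D \<and> z \<in> C}"
  have T: "subspace T"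
    unfolding T_def using C sub by (intro subspace_sums) auto
  have "a \<notin> T"
  proof
    assume "a \<in> T"
    then obtain y z where yz: "a = y + z" "y \<in> kerr D" "z \<in> C"
      by (auto simp: T_def)
    then have "y \<in> kerl D"
      using a sub unfolding C_def by (metis (mono_tags, lifting) add_diff_cancel_right' mem_Collect_eq subspace_diff)
    then have "\<gamma> y = 0" using \<gamma>I yz by blast
    then show False using \<gamma>(1)[of y z] \<gamma>(4) yz by (simp add: C_def)
  qed
  obtain \<alpha> where \<alpha>: "\<And>y z. \<alpha> (y + z) = \<alpha> y + \<alpha> z" "\<And>c y. \<alpha> (c *s y) = c * \<alpha> y"
    "\<And>y. y \<in> T \<Longrightarrow> \<alpha> y = 0" "\<alpha> a = 1"
    using separating_functional[OF T \<open>a \<notin> T\<close>] by blast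
  have \<alpha>r: "\<alpha> y = 0" if "y \<in> kerr D" for y
    using that C subspace_0 \<alpha>(3)[of y] unfolding T_def
    by (metis (mono_tags, lifting) add_0_right mem_Collect_eq)
  have \<alpha>C: "\<alpha> y = 0" if "y \<in> C" for y
    using that sub subspace_0 \<alpha>(3)[of y] unfolding T_def
    by (metis (mono_tags, lifting) add_0_left mem_Collect_eq)
  have \<alpha>l: "\<alpha> y = \<gamma> y" if y: "y \<in> kerl D" for y
  proof -
    have "y + (- \<gamma> y) *s a \<in> C"
      using y a sub unfolding C_def by (auto simp: \<gamma> subspace_add subspace_scale simp del: scale_minus_left)
    from \<alpha>C[OF this] show ?thesis by (simp add: \<alpha> del: scale_minus_left)
  qed
  define \<beta> where "\<beta> = (\<lambda>y. \<alpha> y - \<gamma> y)"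
  define e where "e = (\<lambda>y. \<alpha> y *s a + \<beta> y *s b)"
  have "\<gamma> (a + b) = 0" using \<gamma>L F L by blast
  then have \<beta>b: "\<beta> b = 1" and \<alpha>b: "\<alpha> b = 0" and \<beta>a: "\<beta> a = 0"
    using \<alpha>r[OF b] \<gamma>(1)[of a b] \<gamma>(4) \<alpha>(4) by (auto simp: \<beta>_def neg_eq_iff_add_eq_0 add.commute)
  have \<beta>: "\<beta> (y + z) = \<beta> y + \<beta> z" "\<beta> (c *s y) = c * \<beta> y" for y z c
    by (auto simp: \<beta>_def \<alpha> \<gamma> algebra_simps)
  have el: "e y = \<alpha> y *s a" if "y \<in> kerl D" for y
    using \<alpha>l[OF that] by (simp add: e_def \<beta>_def)
  have er: "e y = \<beta> y *s b" if "y \<in> kerr D" for y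
    using \<alpha>r[OF that] by (simp add: e_def)
  have eL: "e y = \<alpha> y *s (a + b)" if "y \<in> L" for y
    using \<gamma>L[OF that] by (simp add: e_def \<beta>_def scale_right_distrib)
  have ab_space: "a \<in> space D" "b \<in> space D" using a b in_space by auto
  have "linear_between scale (space D) (space D) e"
    using ab_space sub by (auto simp: linear_between_def e_def \<alpha> \<beta> subspace_scale subspace_add
        scale_left_distrib scale_right_distrib)
  moreover have "e ` kerl D \<subseteq> kerl D" using el a sub by (auto simp: subspace_scale)
  moreover have "e ` kerr D \<subseteq> kerr D" using er b sub by (auto simp: subspace_scale)
  moreover have "e ` kerleg D k \<subseteq> kerleg D k" for k
  proof (cases "kerleg D k = {0}")
    case True
    have "e 0 = 0" using el[of 0] sub(2) \<alpha>(2)[of 0 0] by (simp add: subspace_0)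
    with True show ?thesis by simp
  next
    case False
    then have ab: "a + b \<in> kerleg D k" using leg F by blast
    show ?thesis
    proof (cases "a \<in> kerleg D k")
      case True
      then have "b \<in> kerleg D k"
        using ab sub(4)[of k] by (metis add_diff_cancel_left' subspace_diff)
      with True sub(4)[of k] show ?thesis
        by (auto simp: e_def subspace_add subspace_scale)
    next
      case False
      then show ?thesis
        using leg'[of k] eL ab sub(4)[of k] by (auto simp: subspace_scale)
    qed
  qed
  ultimately have "data_map D D e" unfolding data_map_def by blast
  moreover have "e (e y) = e y" for y
    by (simp add: e_def \<alpha> \<beta> \<alpha>b \<beta>a \<beta>b)
  moreover have "e a = a" using el[OF a(1)] \<alpha> by simp
  ultimately have e_id: "e y = y" if "y \<in> space D" for y
    using triv ab_space a(2) that unfolding trivial_idempotents_def by metis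
  have "b \<noteq> 0" using F a by auto
  have lin: "kerl D = span {a}"
  proof
    show "kerl D \<subseteq> span {a}"
      using el e_id in_space by (metis rangeI span_singleton subset_iff)
  qed (use a sub in \<open>simp add: span_minimal\<close>)
  have rin: "kerr D = span {b}"
  proof
    show "kerr D \<subseteq> span {b}"
      using er e_id in_space by (metis rangeI span_singleton subset_iff)
  qed (use b sub in \<open>simp add: span_minimal\<close>)
  have sp: "space D = span {a, b}"
  proof
    show "space D \<subseteq> span {a, b}"
    proof
      fix y assume "y \<in> space D"
      then have "y = \<alpha> y *s a + \<beta> y *s b" using e_id[of y] by (simp add: e_def)
      moreover have "\<alpha> y *s a + \<beta> y *s b \<in> span {a, b}"
        by (intro span_add span_scale span_base) auto
      ultimately show "y \<in> span {a, b}" by simp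
    qed
  qed (use ab_space sub in \<open>simp add: span_minimal\<close>)
  have int: "span {a} \<inter> span {b} = {0}"
  proof -
    have "y = 0" if "y \<in> kerl D" "y \<in> kerr D" for y
    proof -
      have "y = \<alpha> y *s a" using el[OF that(1)] e_id[of y] that in_space by auto
      with \<alpha>r[OF that(2)] show ?thesis by simp
    qed
    then show ?thesis unfolding lin[symmetric] rin[symmetric] using sub subspace_0 by auto
  qed
  have legs: "kerleg D k \<in> {{0}, span {a + b}, space D}" for k
  proof (cases "kerleg D k = {0}")
    case False
    then have ab: "a + b \<in> kerleg D k" using leg F by blast
    show ?thesis
    proof (cases "a \<in> kerleg D k")
      case True
      then have "b \<in> kerleg D k"
        using ab sub(4)[of k] by (metis add_diff_cancel_left' subspace_diff)
      with True have "span {a, b} \<subseteq> kerleg D k" using sub(4) by (simp add: span_minimal)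
      with in_space(3)[of k] sp show ?thesis by auto
    next
      case False
      have "kerleg D k \<subseteq> span {a + b}"
      proof
        fix y assume y: "y \<in> kerleg D k"
        with False leg' have "y \<in> L" by blast
        with y eL e_id in_space have "y = \<alpha> y *s (a + b)" by (metis subsetD)
        then show "y \<in> span {a + b}" by (metis rangeI span_singleton)
      qed
      moreover have "span {a + b} \<subseteq> kerleg D k" using ab sub(4) by (simp add: span_minimal)
      ultimately show ?thesis by auto
    qed
  qed simp
  have "a \<notin> F" using F a by blast
  moreover have "a + b \<noteq> 0"
  proof
    assume "a + b = 0"
    then have "a \<in> kerr D" using b sub by (metis add_eq_0_iff2 subspace_neg)
    then have "a \<in> span {a} \<inter> span {b}" using a lin rin by blast
    then show False using int a by auto
  qed
  ultimately have "kerleg D k0 = span {a + b}"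
    using legs[of k0] F ab_space by auto
  with legs show ?thesis
    unfolding planar_basis_def using a \<open>b \<noteq> 0\<close> int lin rin sp by blast
qed

text \<open>
Look at the first nonzero member \<open>F\<close> of the chain (or the whole space, if the chain is zero) and its
position relative to the left kernel \<open>A\<close> and the right kernel \<open>B\<close>. If \<open>F\<close> meets \<open>A \<inter> B\<close>, \<open>A\<close> or \<open>B\<close>
nontrivially, or is not contained in \<open>A + B\<close>, then a line in \<open>F\<close> splits off. Otherwise some nonzero
\<open>x \<in> F\<close> is a sum \<open>a + b\<close> with \<open>a \<in> A\<close> and \<open>b \<in> B\<close>. Such decompositions differ by elements of \<open>A \<inter> B\<close>;
one that enters the chain as early as possible spans a plane that splits off.
\<close>
lemma thin_or_planar:
  assumes wf: "kernel_data_wf D" and triv: "trivial_idempotents D" and nz: "space D \<noteq> {0}"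
  shows "thin D \<or> (\<exists>a b. planar_basis D a b)"
proof -
  have sub: "subspace (space D)" "subspace (kerl D)" "subspace (kerr D)" "\<And>k. subspace (kerleg D k)"
    and in_space: "kerl D \<subseteq> space D" "kerr D \<subseteq> space D" "\<And>k. kerleg D k \<subseteq> space D"
    and "mono (kerleg D)"
    using wf by (auto simp: kernel_data_wf_def)
  then have leg_mono: "kerleg D j \<subseteq> kerleg D k" if "j \<le> k" for j k
    using that by (simp add: monoD)
  obtain F where F: "F = space D \<or> (\<exists>k. F = kerleg D k)" "F \<noteq> {0}"
    and leg: "kerleg D k = {0} \<or> F \<subseteq> kerleg D k" for k
  proof (cases "\<exists>k. kerleg D k \<noteq> {0}")
    case True
    define k0 where "k0 = (LEAST k. kerleg D k \<noteq> {0})"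
    have "kerleg D k0 \<noteq> {0}" unfolding k0_def using True by (rule LeastI_ex)
    moreover have "kerleg D k = {0} \<or> kerleg D k0 \<subseteq> kerleg D k" for k
      using leg_mono[of k0 k] Least_le[of "\<lambda>k. kerleg D k \<noteq> {0}" k] unfolding k0_def by blast
    ultimately show thesis using that by blast
  qed (use nz that in blast)
  have subF: "subspace F" and F_space: "F \<subseteq> space D" using F sub in_space by (elim disjE exE; simp)+
  obtain x0 where x0: "x0 \<in> F" "x0 \<noteq> 0" using F(2) subspace_0[OF subF] by blast
  have line: "thin D" if "x \<in> F" "subspace S" "x \<notin> S"
    "x \<in> kerl D \<or> kerl D \<subseteq> S" "x \<in> kerr D \<or> kerr D \<subseteq> S" for x S
  proof (rule thin_if_line_splits[OF wf triv _ _ _ that(2-5)])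
    show "x \<in> space D" using that F_space by blast
    show "x \<noteq> 0" using that subspace_0 by blast
    show "kerleg D k = {0} \<or> x \<in> kerleg D k" for k using leg[of k] that(1) by blast
  qed
  define sum where "sum = {y + z | y z. y \<in> kerl D \<and> z \<in> kerr D}"
  have subsum: "subspace sum" unfolding sum_def using sub by (intro subspace_sums)
  have lsum: "kerl D \<subseteq> sum" and rsum: "kerr D \<subseteq> sum"
    unfolding sum_def using sub subspace_0 by force+
  consider (both) x where "x \<in> F" "x \<in> kerl D" "x \<in> kerr D" "x \<noteq> 0"
    | (left) x where "x \<in> F" "x \<in> kerl D" "x \<notin> kerr D"
    | (right) x where "x \<in> F" "x \<in> kerr D" "x \<notin> kerl D"
    | (none) x where "x \<in> F" "x \<notin> sum"
    | (plane) "F \<inter> kerl D \<subseteq> {0}" "F \<inter> kerr D \<subseteq> {0}" "F \<subseteq> sum"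
    by blast
  then show ?thesis
  proof cases
    case both
    then show ?thesis using line[of x "{0}"] subspace_single_0 by auto
  next
    case left
    then show ?thesis using line[of x "kerr D"] sub by auto
  next
    case right
    then show ?thesis using line[of x "kerl D"] sub by auto
  next
    case none
    then show ?thesis using line[of x sum] subsum lsum rsum by auto
  next
    case plane
    then obtain a0 b0 where ab0: "x0 = a0 + b0" "a0 \<in> kerl D" "b0 \<in> kerr D"
      using x0 unfolding sum_def by blast
    define Z where "Z = {y \<in> kerl D. x0 - y \<in> kerr D}"
    have "a0 \<in> Z" using ab0 by (simp add: Z_def)
    have "0 \<notin> Z" using x0 plane by (auto simp: Z_def)
    then have FZ: "F \<inter> Z = {}" using plane by (auto simp: Z_def)
    have "F \<noteq> space D" using FZ \<open>a0 \<in> Z\<close> in_space by (auto simp: Z_def)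
    then obtain k0 where k0: "F = kerleg D k0" using F by blast
    \<comment> \<open>\<open>L\<close> is the part of the chain that no decomposition of \<open>x0\<close> reaches. The choice of \<open>a\<close> below puts
      \<open>a\<close> into every member of the chain outside \<open>L\<close>.\<close>
    define L where "L = (\<Union>k\<in>{k. kerleg D k \<inter> Z = {}}. kerleg D k)"
    have FL: "F \<subseteq> L" using FZ unfolding L_def k0 by blast
    have subL: "subspace L"
    proof (rule subspaceI)
      show "0 \<in> L" using FL subspace_0[OF subF] by blast
      show "c *s y \<in> L" if "y \<in> L" for c y
        using that sub unfolding L_def by (auto simp: subspace_scale)
      fix y z assume "y \<in> L" "z \<in> L"
      then obtain j k where jk: "y \<in> kerleg D j" "kerleg D j \<inter> Z = {}"
        "z \<in> kerleg D k" "kerleg D k \<inter> Z = {}" unfolding L_def by blast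
      then have "y \<in> kerleg D (max j k)" "z \<in> kerleg D (max j k)"
        using leg_mono[of j "max j k"] leg_mono[of k "max j k"] by auto
      then have "y + z \<in> kerleg D (max j k)" using sub by (simp add: subspace_add)
      moreover have "kerleg D (max j k) \<inter> Z = {}" using jk by (simp add: max_def)
      ultimately show "y + z \<in> L" unfolding L_def by blast
    qed
    obtain a where a: "a \<in> Z" and legZ: "kerleg D k \<inter> Z = {} \<or> a \<in> kerleg D k" for k
    proof (cases "\<exists>k. kerleg D k \<inter> Z \<noteq> {}")
      case True
      define k1 where "k1 = (LEAST k. kerleg D k \<inter> Z \<noteq> {})"
      have "kerleg D k1 \<inter> Z \<noteq> {}" unfolding k1_def using True by (rule LeastI_ex)
      then obtain a where "a \<in> kerleg D k1" "a \<in> Z" by blast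
      moreover have "kerleg D k \<inter> Z = {} \<or> kerleg D k1 \<subseteq> kerleg D k" for k
        using leg_mono[of k1 k] Least_le[of "\<lambda>k. kerleg D k \<inter> Z \<noteq> {}" k] unfolding k1_def by blast
      ultimately show thesis using that by blast
    qed (use \<open>a0 \<in> Z\<close> that in blast)
    have "planar_basis D a (x0 - a)"
    proof (rule planar_if_plane_splits[OF wf triv _ _ _ subF _ plane(1,2) k0 subL FL])
      show "a \<in> kerl D" "a \<noteq> 0" "x0 - a \<in> kerr D" using a \<open>0 \<notin> Z\<close> by (auto simp: Z_def)
      show "a + (x0 - a) \<in> F" using x0 by simp
      show "a + (x0 - a) - y \<notin> kerr D" if "y \<in> L" "y \<in> kerl D" for y
        using that unfolding L_def Z_def by auto
      show "kerleg D k = {0} \<or> F \<subseteq> kerleg D k" for k by (rule leg)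
      show "kerleg D k \<subseteq> L \<or> a \<in> kerleg D k" for k using legZ[of k] unfolding L_def by blast
    qed
    then show ?thesis by blast
  qed
qed

section \<open>Maps between indecomposable kernel configurations\<close>

text \<open>
The configurations of indecomposable representations, named after the positive roots of \<open>D\<^sub>\<infinity>\<close>.
\<close>
definition root_data :: "'v kernel_data \<Rightarrow> bool" where
  "root_data D \<longleftrightarrow> kernel_data_wf D \<and> (thin D \<or> (\<exists>a b. planar_basis D a b))"

text \<open>
Numbered so that nonzero maps cannot increase it: a line on which both leaf maps are injective can
map to every kind of configuration, and a line killed in both leaves maps only to its own kind.
\<close>
definition kernel_rank :: "'v kernel_data \<Rightarrow> nat" where
  "kernel_rank D = (if kerl D = {0} \<and> kerr D = {0} then 2
     else if kerl D = space D \<and> kerr D = space D then 0 else 1)"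

text \<open>
The infimum of the empty set in \<^typ>\<open>enat\<close> is \<open>\<infinity>\<close>, which is the right value for a chain that never
becomes nonzero, respectively never fills the space.
\<close>
definition first_nonzero :: "'v kernel_data \<Rightarrow> enat" where
  "first_nonzero D = Inf (enat ` {k. kerleg D k \<noteq> {0}})"

definition first_full :: "'v kernel_data \<Rightarrow> enat" where
  "first_full D = Inf (enat ` {k. kerleg D k = space D})"

lemma planar_independent:
  assumes "planar_basis D a b" "c *s a + d *s b = 0"
  shows "c = 0 \<and> d = 0"
proof -
  have "c *s a = (- d) *s b" using assms(2) by (simp add: eq_neg_iff_add_eq_0)
  then have "c *s a \<in> span {a} \<inter> span {b}"
    by (metis IntI rangeI span_singleton)
  then have "c *s a = 0" using assms(1) unfolding planar_basis_def by blast
  then show ?thesis using assms by (auto simp: planar_basis_def)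
qed

lemma planar_elements:
  assumes "planar_basis D a b" "y \<in> space D"
  obtains c d where "y = c *s a + d *s b"
proof -
  obtain c where "y - c *s a \<in> span {b}"
    using assms span_breakdown_eq[of y a "{b}"] by (auto simp: planar_basis_def)
  then obtain d where "y - c *s a = d *s b" by (auto simp: span_singleton)
  then show thesis using that[of c d] by (simp add: diff_eq_eq add.commute)
qed

lemma planar_members:
  assumes "planar_basis D a b"
  shows "a \<in> kerl D" "b \<in> kerr D" "a \<in> space D" "b \<in> space D" "a + b \<in> space D"
    "a + b \<noteq> 0" "a \<notin> span {b}" "b \<notin> span {a}"
    "span {a} \<inter> span {a + b} \<subseteq> {0}" "span {b} \<inter> span {a + b} \<subseteq> {0}"
    "span {a + b} \<noteq> space D"
proof -
  note p = assms[unfolded planar_basis_def]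
  show "a \<in> kerl D" "b \<in> kerr D" using p span_base by auto
  show ab: "a \<in> space D" "b \<in> space D" "a + b \<in> space D" using p span_base span_add by auto
  show "a + b \<noteq> 0" using planar_independent[OF assms, of 1 1] by auto
  show "a \<notin> span {b}" "b \<notin> span {a}" using p span_base by blast+
  have "y = 0" if "y = c *s a" "y = d *s (a + b)" for y c d
    using planar_independent[OF assms, of "c - d" "- d"] that
    by (simp add: scale_left_diff_distrib scale_right_distrib algebra_simps)
  then show ia: "span {a} \<inter> span {a + b} \<subseteq> {0}" unfolding span_singleton by blast
  have "y = 0" if "y = c *s b" "y = d *s (a + b)" for y c d
    using planar_independent[OF assms, of "- d" "c - d"] that
    by (simp add: scale_left_diff_distrib scale_right_distrib algebra_simps)
  then show "span {b} \<inter> span {a + b} \<subseteq> {0}" unfolding span_singleton by blast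
  show "span {a + b} \<noteq> space D" using ia ab(1) p span_base[of a "{a}"] by auto
qed

lemma planar_legs:
  assumes "planar_basis D a b"
  shows "kerleg D k = {0} \<or> kerleg D k = span {a + b} \<or> kerleg D k = space D"
proof -
  have "kerleg D k \<in> {{0}, span {a + b}, space D}"
    using assms unfolding planar_basis_def by (elim conjE allE)
  then show ?thesis by blast
qed

lemma planar_rank: "planar_basis D a b \<Longrightarrow> kernel_rank D = 1"
  using planar_members[of D a b] unfolding kernel_rank_def planar_basis_def by auto

lemma subspace_of_thin:
  assumes "thin D" "subspace T" "T \<subseteq> space D"
  shows "T = {0} \<or> T = space D"
  using assms subspace_of_line unfolding thin_def by metis

text \<open>
Together with \<open>root_data_kernels_disjoint\<close> this states what the types of configurations other than
those of rank 2, respectively 0, have in common, which spares a comparison of all pairs of types.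
\<close>
lemma root_data_sum:
  assumes D: "root_data D" "kernel_rank D \<noteq> 2" "y \<in> space D"
  obtains u v where "u \<in> kerl D" "v \<in> kerr D" "y = u + v"
proof (cases "thin D")
  case True
  have wf: "kernel_data_wf D" using D by (simp add: root_data_def)
  then have sub: "subspace (kerl D)" "subspace (kerr D)" "kerl D \<subseteq> space D" "kerr D \<subseteq> space D"
    by (auto simp: kernel_data_wf_def)
  have "kerl D = space D \<or> kerr D = space D"
    using subspace_of_thin[OF True sub(1,3)] subspace_of_thin[OF True sub(2,4)] D(2)
    by (auto simp: kernel_rank_def)
  then show thesis
    using that[of y 0] that[of 0 y] D(3) sub subspace_0 by auto
next
  case False
  then obtain a b where p: "planar_basis D a b" using D by (auto simp: root_data_def)
  from planar_elements[OF p D(3)] obtain c d where "y = c *s a + d *s b" .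
  with p show thesis using that[of "c *s a" "d *s b"]
    by (auto simp: planar_basis_def span_base span_scale)
qed

lemma root_data_kernels_disjoint:
  assumes D: "root_data D" "kernel_rank D \<noteq> 0"
  shows "kerl D \<inter> kerr D = {0}"
proof (cases "thin D")
  case True
  have wf: "kernel_data_wf D" using D by (simp add: root_data_def)
  then have sub: "subspace (kerl D)" "subspace (kerr D)" "kerl D \<subseteq> space D" "kerr D \<subseteq> space D"
    by (auto simp: kernel_data_wf_def)
  have "kerl D = {0} \<or> kerr D = {0}"
    using subspace_of_thin[OF True sub(1,3)] subspace_of_thin[OF True sub(2,4)] D(2)
    by (auto simp: kernel_rank_def split: if_splits)
  then show ?thesis using sub subspace_0 by auto
next
  case False
  then obtain a b where p: "planar_basis D a b" using D by (auto simp: root_data_def)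
  then show ?thesis by (simp add: planar_basis_def)
qed

context
  fixes D D' :: "'v kernel_data" and f :: "'v \<Rightarrow> 'v"
  assumes D: "root_data D" and D': "root_data D'"
    and f: "data_map D D' f" and f_nonzero: "\<exists>y\<in>space D. f y \<noteq> 0"
begin

lemma data_map_add: "\<lbrakk>y \<in> space D; z \<in> space D\<rbrakk> \<Longrightarrow> f (y + z) = f y + f z"
  and data_map_scale: "y \<in> space D \<Longrightarrow> f (c *s y) = c *s f y"
  and data_map_space: "y \<in> space D \<Longrightarrow> f y \<in> space D'"
  and data_map_kerl: "y \<in> kerl D \<Longrightarrow> f y \<in> kerl D'"
  and data_map_kerr: "y \<in> kerr D \<Longrightarrow> f y \<in> kerr D'"
  and data_map_kerleg: "y \<in> kerleg D k \<Longrightarrow> f y \<in> kerleg D' k"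
  using f by (simp_all add: data_map_def linear_between_def image_subset_iff)

lemma domain_subspaces: "subspace (space D)" "subspace (kerl D)" "subspace (kerr D)" "subspace (kerleg D k)"
    "kerl D \<subseteq> space D" "kerr D \<subseteq> space D" "kerleg D k \<subseteq> space D"
  and codomain_subspaces: "subspace (space D')" "subspace (kerl D')" "subspace (kerr D')" "subspace (kerleg D' k)"
    "kerl D' \<subseteq> space D'" "kerr D' \<subseteq> space D'" "kerleg D' k \<subseteq> space D'"
  using D D' by (auto simp: root_data_def kernel_data_wf_def)

lemma data_map_0: "f 0 = 0"
  using data_map_scale[of 0 0] domain_subspaces(1) subspace_0 by auto

lemma thin_generator_survives:
  assumes "space D = span {x}"
  shows "f x \<noteq> 0"
  using f_nonzero data_map_scale[of x] assms span_base[of x "{x}"] by (auto simp: span_singleton)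

text \<open>
A target in which both leaf kernels vanish forces \<open>f\<close> to kill the sum of the leaf kernels of the
source, and that sum is everything unless the source has rank 2. A source of rank 0 is mapped into
the intersection of the leaf kernels of the target, which is zero unless the target has rank 0.
\<close>
lemma kernel_rank_decreases: "kernel_rank D' \<le> kernel_rank D"
proof (rule ccontr)
  assume less: "\<not> ?thesis"
  obtain y where y: "y \<in> space D" "f y \<noteq> 0" using f_nonzero by blast
  have "kernel_rank D \<noteq> 2" using less by (auto simp: kernel_rank_def split: if_splits)
  from root_data_sum[OF D this y(1)] obtain u v where
    uv: "u \<in> kerl D" "v \<in> kerr D" "y = u + v" .
  consider "kernel_rank D' = 2" | "kernel_rank D = 0" "kernel_rank D' \<noteq> 0"
    using less by (auto simp: kernel_rank_def split: if_splits)
  then show False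
  proof cases
    case 1
    then have "f u = 0" "f v = 0"
      using uv data_map_kerl data_map_kerr by (auto simp: kernel_rank_def split: if_splits)
    then show False using uv y data_map_add[of u v] subsetD[OF domain_subspaces(5)] subsetD[OF domain_subspaces(6)] by simp
  next
    case 2
    then have "y \<in> kerl D" "y \<in> kerr D"
      using y by (auto simp: kernel_rank_def split: if_splits)
    then show False
      using root_data_kernels_disjoint[OF D' 2(2)] data_map_kerl data_map_kerr y by blast
  qed
qed

text \<open>
If \<open>f\<close> kills \<open>a + b\<close>, then \<open>f a = - f b\<close> lies in both leaf kernels of the target, hence is zero.
\<close>
lemma planar_generator_survives:
  assumes "kernel_rank D' \<noteq> 0" and p: "planar_basis D a b"
  shows "f (a + b) \<noteq> 0"
proof
  note m = planar_members[OF p]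
  assume "f (a + b) = 0"
  then have "f a = - f b" using m data_map_add by (simp add: eq_neg_iff_add_eq_0)
  then have "f a \<in> kerl D' \<inter> kerr D'"
    using data_map_kerl[OF m(1)] data_map_kerr[OF m(2)] subspace_neg[OF codomain_subspaces(3)] by simp
  then have "f a = 0" "f b = 0"
    using root_data_kernels_disjoint[OF D' assms(1)] \<open>f a = - f b\<close> by auto
  obtain y where y: "y \<in> space D" "f y \<noteq> 0" using f_nonzero by blast
  from planar_elements[OF p y(1)] obtain c d where "y = c *s a + d *s b" .
  then have "f y = c *s f a + d *s f b" using m data_map_add data_map_scale domain_subspaces by (simp add: subspace_scale)
  then show False using y \<open>f a = 0\<close> \<open>f b = 0\<close> by simp
qed

text \<open>
All nonzero members of the chain share a vector that \<open>f\<close> does not kill: a generator of the line, or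
\<open>a + b\<close> in a plane.
\<close>
lemma nonzero_legs_persist:
  assumes "kernel_rank D' = kernel_rank D" and k: "kerleg D k \<noteq> {0}"
  shows "kerleg D' k \<noteq> {0}"
proof (cases "thin D")
  case True
  then obtain x where x: "space D = span {x}" by (auto simp: thin_def)
  have "x \<in> kerleg D k"
    using subspace_of_thin[OF True, of "kerleg D k"] domain_subspaces k x span_base by auto
  then show ?thesis using thin_generator_survives[OF x] data_map_kerleg by fastforce
next
  case False
  then obtain a b where p: "planar_basis D a b" using D by (auto simp: root_data_def)
  have "kerleg D k = span {a + b} \<or> kerleg D k = space D"
    using planar_legs[OF p] k by metis
  then have "a + b \<in> kerleg D k"
    using planar_members(5)[OF p] span_base[of "a + b" "{a + b}"] by auto
  moreover have "f (a + b) \<noteq> 0"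
    using planar_generator_survives p planar_rank[OF p] assms by auto
  ultimately show ?thesis using data_map_kerleg by fastforce
qed

text \<open>
In a plane, a proper member of the chain meets both leaf kernels trivially. If it contained the image
of \<open>f\<close>, then \<open>f\<close> would kill both leaf kernels of the source, hence everything.
\<close>
lemma full_legs_persist:
  assumes "kernel_rank D' = kernel_rank D" and k: "kerleg D k = space D"
  shows "kerleg D' k = space D'"
proof (cases "thin D'")
  case True
  have "kerleg D' k \<noteq> {0}" using f_nonzero k data_map_kerleg by blast
  then show ?thesis
    using subspace_of_thin[OF True, of "kerleg D' k"] codomain_subspaces by auto
next
  case False
  then obtain a b where p: "planar_basis D' a b" using D' by (auto simp: root_data_def)
  show ?thesis
  proof (rule ccontr)
    assume "kerleg D' k \<noteq> space D'"
    then have "kerleg D' k \<in> {{0}, span {a + b}}"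
      using planar_legs[OF p] by blast
    then have sub: "kerleg D' k \<subseteq> span {a + b}" using span_zero by auto
    obtain y where y: "y \<in> space D" "f y \<noteq> 0" using f_nonzero by blast
    have "kernel_rank D \<noteq> 2" using assms planar_rank[OF p] by simp
    from root_data_sum[OF D this y(1)] obtain u v where
      uv: "u \<in> kerl D" "v \<in> kerr D" "y = u + v" .
    have "f u \<in> kerl D' \<inter> kerleg D' k" "f v \<in> kerr D' \<inter> kerleg D' k"
      using uv data_map_kerl data_map_kerr data_map_kerleg k domain_subspaces by auto
    then have "f u = 0" "f v = 0"
      using sub planar_members(9,10)[OF p] p unfolding planar_basis_def by auto
    then show False using uv y data_map_add[of u v] subsetD[OF domain_subspaces(5)] subsetD[OF domain_subspaces(6)] by simp
  qed
qed

lemma data_map_span: "x \<in> space D \<Longrightarrow> f ` span {x} = span {f x}"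
  by (auto simp: span_singleton data_map_scale image_image)

text \<open>
The delicate case is rank 1, where exactly one of the leaf kernels is zero and the other one is the
whole line. As \<open>f\<close> maps a full leaf kernel to a full one, it cannot interchange the two sides.
\<close>
lemma kernels_match:
  assumes "inj_on f (space D)" "f ` space D = space D'" "kernel_rank D' = kernel_rank D"
    and legs_zero: "\<And>k. kerleg D k = {0} \<longleftrightarrow> kerleg D' k = {0}"
    and "thin D" "thin D'"
  shows "f ` kerl D = kerl D' \<and> f ` kerr D = kerr D' \<and> (\<forall>k. f ` kerleg D k = kerleg D' k)"
proof -
  have match: "f ` T = T'" if T: "subspace T" "T \<subseteq> space D" "subspace T'" "T' \<subseteq> space D'"
    "f ` T \<subseteq> T'" "T = {0} \<Longrightarrow> T' = {0}" for T T'
  proof (cases "T = {0}")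
    case False
    then have "T = space D" using subspace_of_thin assms(5) T by blast
    then have "space D' \<subseteq> T'" using T assms(2) by simp
    with \<open>T = space D\<close> T assms(2) show ?thesis by auto
  qed (use T data_map_0 in auto)
  have not_both: "kernel_rank D' \<noteq> 1 \<or> kerl D' \<noteq> space D' \<or> kerr D' \<noteq> space D'"
    by (simp add: kernel_rank_def)
  note cases = subspace_of_thin[OF \<open>thin D\<close> domain_subspaces(2,5)] subspace_of_thin[OF \<open>thin D\<close> domain_subspaces(3,6)]
    subspace_of_thin[OF \<open>thin D'\<close> codomain_subspaces(2,5)] subspace_of_thin[OF \<open>thin D'\<close> codomain_subspaces(3,6)]
  obtain y where "y \<in> space D" "f y \<noteq> 0" using f_nonzero by blast
  then have nz: "space D \<noteq> {0}" "space D' \<noteq> {0}" using data_map_0 data_map_space[of y] by force+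
  have fl: "f ` kerl D \<subseteq> kerl D'" and fr: "f ` kerr D \<subseteq> kerr D'" using data_map_kerl data_map_kerr by auto
  have "kerl D' = {0}" if l: "kerl D = {0}"
  proof (cases "kerr D = {0}")
    case True
    then show ?thesis using l assms(3) by (auto simp: kernel_rank_def split: if_splits)
  next
    case False
    then have "kerr D = space D" using cases by blast
    then have "kernel_rank D = 1" "kerr D' = space D'"
      using l False nz fr assms(2) codomain_subspaces(6) by (auto simp: kernel_rank_def)
    then show ?thesis using assms(3) cases not_both by argo
  qed
  moreover have "kerr D' = {0}" if r: "kerr D = {0}"
  proof (cases "kerl D = {0}")
    case True
    then show ?thesis using r assms(3) by (auto simp: kernel_rank_def split: if_splits)
  next
    case False
    then have "kerl D = space D" using cases by blast
    then have "kernel_rank D = 1" "kerl D' = space D'"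
      using r False nz fl assms(2) codomain_subspaces(5) by (auto simp: kernel_rank_def)
    then show ?thesis using assms(3) cases not_both by argo
  qed
  moreover have "f ` kerleg D k = kerleg D' k" for k
    by (rule match) (use domain_subspaces codomain_subspaces data_map_kerleg legs_zero in auto)
  ultimately show ?thesis
    using match[OF domain_subspaces(2,5) codomain_subspaces(2,5) fl] match[OF domain_subspaces(3,6) codomain_subspaces(3,6) fr] by simp
qed

text \<open>
The chain tells lines and planes apart, since only in a plane some \<open>K\<^sub>k\<close> lies strictly between \<open>0\<close> and
the whole space. Between planes, \<open>f\<close> maps the lines \<open>\<langle>a\<rangle>\<close>, \<open>\<langle>b\<rangle>\<close>, \<open>\<langle>a + b\<rangle>\<close> to \<open>\<langle>a'\<rangle>\<close>, \<open>\<langle>b'\<rangle>\<close>,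
\<open>\<langle>a' + b'\<rangle>\<close>, which forces \<open>f a\<close> and \<open>f b\<close> to be multiples of \<open>a'\<close> and \<open>b'\<close> by the same scalar.
\<close>
lemma iso_if_same_invariants:
  assumes rank: "kernel_rank D' = kernel_rank D"
    and legs_zero: "\<And>k. kerleg D k = {0} \<longleftrightarrow> kerleg D' k = {0}"
    and legs_full: "\<And>k. kerleg D k = space D \<longleftrightarrow> kerleg D' k = space D'"
  shows "data_iso D D' f"
proof (cases "thin D")
  case True
  then obtain x where x: "space D = span {x}" by (auto simp: thin_def)
  have "thin D'"
  proof (rule ccontr)
    assume "\<not> thin D'"
    then obtain a b where p: "planar_basis D' a b" using D' by (auto simp: root_data_def)
    then obtain k where "kerleg D' k = span {a + b}" by (auto simp: planar_basis_def)
    then have "kerleg D' k \<noteq> {0}" "kerleg D' k \<noteq> space D'"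
      using planar_members(6,11)[OF p] span_base[of "a + b" "{a + b}"] by auto
    moreover have "kerleg D k = {0} \<or> kerleg D k = space D"
      using subspace_of_thin[OF True] domain_subspaces by blast
    ultimately show False using legs_zero legs_full by blast
  qed
  have x_space: "x \<in> space D" using x span_base by auto
  have "f x \<noteq> 0" using thin_generator_survives x by blast
  have "inj_on f (space D)"
  proof (rule inj_onI)
    fix y z assume "y \<in> space D" "z \<in> space D" "f y = f z"
    then obtain c d where yz: "y = c *s x" "z = d *s x" using x by (auto simp: span_singleton)
    then have "c *s f x = d *s f x" using \<open>f y = f z\<close> data_map_scale[OF x_space] by simp
    then show "y = z" using \<open>f x \<noteq> 0\<close> yz by simp
  qed
  moreover have "f ` space D = space D'"
  proof -
    have "f ` space D = span {f x}" using data_map_span x x_space by simp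
    moreover have "span {f x} = space D'"
      using subspace_of_thin[OF \<open>thin D'\<close>, of "span {f x}"] \<open>f x \<noteq> 0\<close> data_map_space[OF x_space]
        codomain_subspaces(1) span_base[of "f x" "{f x}"] by (auto simp: span_minimal)
    ultimately show ?thesis by simp
  qed
  ultimately show ?thesis
    using kernels_match[OF _ _ rank legs_zero True \<open>thin D'\<close>] unfolding data_iso_def by blast
next
  case False
  then obtain a b where p: "planar_basis D a b" using D by (auto simp: root_data_def)
  note m = planar_members[OF p]
  obtain k0 where k0: "kerleg D k0 = span {a + b}" using p by (auto simp: planar_basis_def)
  have k0_mid: "kerleg D k0 \<noteq> {0}" "kerleg D k0 \<noteq> space D"
    using k0 m(6,11) span_base[of "a + b" "{a + b}"] by auto
  have "\<not> thin D'"
    using subspace_of_thin[of D' "kerleg D' k0"] codomain_subspaces k0_mid legs_zero legs_full by blast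
  then obtain a' b' where p': "planar_basis D' a' b'" using D' by (auto simp: root_data_def)
  note m' = planar_members[OF p']
  have "kerleg D' k0 = span {a' + b'}"
    using planar_legs[OF p'] k0_mid legs_zero legs_full by metis
  then have "f (a + b) \<in> span {a' + b'}" using k0 data_map_kerleg span_base[of "a + b" "{a + b}"] by auto
  moreover have "f a \<in> span {a'}" "f b \<in> span {b'}"
    using m data_map_kerl data_map_kerr p' by (auto simp: planar_basis_def)
  ultimately obtain c d e where cde: "f (a + b) = e *s (a' + b')" "f a = c *s a'" "f b = d *s b'"
    by (auto simp: span_singleton)
  moreover have "f (a + b) = f a + f b" using m data_map_add by simp
  ultimately have "(c - e) *s a' + (d - e) *s b' = 0"
    by (simp add: scale_left_diff_distrib scale_right_distrib algebra_simps)
  then have "c = e" "d = e" using planar_independent[OF p'] by fastforce+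
  then have fa: "f a = e *s a'" and fb: "f b = e *s b'" using cde by auto
  have "e \<noteq> 0"
    using planar_generator_survives[OF _ p] planar_rank[OF p] rank cde(1) by auto
  have f_comb: "f (p *s a + q *s b) = e *s (p *s a' + q *s b')" for p q
  proof -
    have "f (p *s a + q *s b) = p *s f a + q *s f b"
      using m data_map_add data_map_scale domain_subspaces by (simp add: subspace_scale)
    then show ?thesis by (simp add: fa fb scale_right_distrib mult.commute)
  qed
  have inj: "inj_on f (space D)"
  proof (rule inj_onI)
    fix y z assume yz: "y \<in> space D" "z \<in> space D" "f y = f z"
    from planar_elements[OF p yz(1)] obtain p1 q1 where y: "y = p1 *s a + q1 *s b" .
    from planar_elements[OF p yz(2)] obtain p2 q2 where z: "z = p2 *s a + q2 *s b" .
    have "p1 *s a' + q1 *s b' = p2 *s a' + q2 *s b'"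
      using yz(3) \<open>e \<noteq> 0\<close> unfolding y z f_comb by simp
    then have "(p1 - p2) *s a' + (q1 - q2) *s b' = 0"
      by (simp add: scale_left_diff_distrib algebra_simps)
    then have "p1 = p2 \<and> q1 = q2" using planar_independent[OF p'] by fastforce
    then show "y = z" using y z by simp
  qed
  have surj: "f ` space D = space D'"
  proof
    show "space D' \<subseteq> f ` space D"
    proof
      fix y assume "y \<in> space D'"
      from planar_elements[OF p' this] obtain p q where y: "y = p *s a' + q *s b'" .
      have "y = f ((p / e) *s a + (q / e) *s b)"
        unfolding f_comb y using \<open>e \<noteq> 0\<close> by (simp add: scale_right_distrib)
      moreover have "(p / e) *s a + (q / e) *s b \<in> space D"
        using m domain_subspaces by (simp add: subspace_add subspace_scale)
      ultimately show "y \<in> f ` space D" by blast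
    qed
  qed (use data_map_space in auto)
  have span_ab: "f ` span {a} = span {a'}" "f ` span {b} = span {b'}"
    "f ` span {a + b} = span {a' + b'}"
    using data_map_span[OF m(3)] data_map_span[OF m(4)] data_map_span[OF m(5)] fa fb cde(1) \<open>e \<noteq> 0\<close>
    by (simp_all add: span_scaled)
  have "f ` kerleg D k = kerleg D' k" for k
  proof -
    consider "kerleg D k = {0}" | "kerleg D k = space D"
      | "kerleg D k = span {a + b}" "kerleg D k \<noteq> {0}" "kerleg D k \<noteq> space D"
      using planar_legs[OF p] by metis
    then show ?thesis
    proof cases
      case 1
      then show ?thesis using legs_zero[of k] data_map_0 by simp
    next
      case 2
      then show ?thesis using legs_full[of k] surj by simp
    next
      case 3
      then have "kerleg D' k = span {a' + b'}"
        using planar_legs[OF p'] legs_zero[of k] legs_full[of k] by metis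
      with 3 show ?thesis using span_ab by simp
    qed
  qed
  then show ?thesis using inj surj span_ab p p' by (simp add: planar_basis_def data_iso_def)
qed

end

text \<open>
An increasing property of indices is recovered from its threshold, so equal measures mean that the
two chains become nonzero and full at the same places.
\<close>
lemma Inf_enat_upclosed:
  assumes "\<And>j k. j \<in> S \<Longrightarrow> j \<le> k \<Longrightarrow> k \<in> S"
  shows "k \<in> S \<longleftrightarrow> Inf (enat ` S) \<le> enat k"
proof
  show "k \<in> S \<Longrightarrow> Inf (enat ` S) \<le> enat k" by (simp add: Inf_lower)
  assume le: "Inf (enat ` S) \<le> enat k"
  then have "S \<noteq> {}" by (auto simp: Inf_enat_def)
  then have "Inf (enat ` S) \<in> enat ` S"
    unfolding Inf_enat_def by (metis (mono_tags) LeastI ex_in_conv image_is_empty)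
  then show "k \<in> S" using assms le by auto
qed

definition data_measure :: "'v kernel_data \<Rightarrow> nat \<times> enat \<times> enat" where
  "data_measure D = (kernel_rank D, first_nonzero D, first_full D)"

definition measure_order :: "(nat \<times> enat \<times> enat) rel" where
  "measure_order = less_than <*lex*> {(x, y). x < y} <*lex*> {(x, y). x < y}"

text \<open>
The rank comes first in the order because the first threshold can go up when the rank drops: it does
so when a plane is mapped onto a line that is killed in both leaves and survives further along the
leg than \<open>a + b\<close>.
\<close>
lemma data_measure_decreases:
  assumes D: "root_data D" and D': "root_data D'" and f: "data_map D D' f"
    and nz: "\<exists>y\<in>space D. f y \<noteq> 0"
  shows "(data_measure D', data_measure D) \<in> measure_order \<or>
    data_iso D D' f"
proof (cases "(data_measure D', data_measure D) \<in> measure_order")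
  case notless: False
  have up: "kerleg E k \<noteq> {0} \<longleftrightarrow> first_nonzero E \<le> enat k"
    "kerleg E k = space E \<longleftrightarrow> first_full E \<le> enat k" if "root_data E" for E k
  proof -
    have E: "mono (kerleg E)" "\<And>k. subspace (kerleg E k)" "\<And>k. kerleg E k \<subseteq> space E"
      using that by (auto simp: root_data_def kernel_data_wf_def)
    have m: "kerleg E i \<subseteq> kerleg E j" if "i \<le> j" for i j using E(1) that by (simp add: monoD)
    have "k \<in> {k. kerleg E k \<noteq> {0}} \<longleftrightarrow> first_nonzero E \<le> enat k"
      unfolding first_nonzero_def
      by (rule Inf_enat_upclosed) (use m E(2) subspace_0 in blast)
    then show "kerleg E k \<noteq> {0} \<longleftrightarrow> first_nonzero E \<le> enat k" by simp
    have "k \<in> {k. kerleg E k = space E} \<longleftrightarrow> first_full E \<le> enat k"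
      unfolding first_full_def
      by (rule Inf_enat_upclosed) (use m E(3) in blast)
    then show "kerleg E k = space E \<longleftrightarrow> first_full E \<le> enat k" by simp
  qed
  have rank: "kernel_rank D' = kernel_rank D"
    using kernel_rank_decreases[OF D D' f nz] notless by (auto simp: measure_order_def data_measure_def)
  have "first_nonzero D' \<le> first_nonzero D" "first_full D' \<le> first_full D"
    unfolding first_nonzero_def first_full_def
    using nonzero_legs_persist[OF D D' f nz rank] full_legs_persist[OF D D' f nz rank]
    by (intro Inf_superset_mono image_mono subsetI CollectI; blast)+
  then have "first_nonzero D' = first_nonzero D" "first_full D' = first_full D"
    using notless rank by (auto simp: measure_order_def data_measure_def)
  then have "kerleg D k \<noteq> {0} \<longleftrightarrow> kerleg D' k \<noteq> {0}"
    and full: "kerleg D k = space D \<longleftrightarrow> kerleg D' k = space D'" for k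
    by (simp_all only: up[OF D] up[OF D'])
  then have "kerleg D k = {0} \<longleftrightarrow> kerleg D' k = {0}" for k by metis
  from iso_if_same_invariants[OF D D' f nz rank this full] show ?thesis ..
qed simp

end

section \<open>Representations and kernels at a vertex of the leg\<close>

lemma verts_mountain [simp]: "verts D_inf_mountain = UNIV"
  and tail_mountain [simp]: "tail D_inf_mountain = fst"
  and head_mountain [simp]: "head D_inf_mountain = snd"
  by (simp_all add: D_inf_mountain_def)

lemma ball_arcs_mountain:
  "(\<forall>a\<in>arcs D_inf_mountain. P a) \<longleftrightarrow>
     (\<forall>w\<in>{Vu, Vu'}. P (Vn 0, w)) \<and> (\<forall>j. P (Vn j, Vn (Suc j)))"
  by (auto simp: D_inf_mountain_def)

lemma wf_mountain: "wf_digraph D_inf_mountain"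
  by unfold_locales simp_all

primrec transport ::
  "(mountain_vertex, mountain_vertex \<times> mountain_vertex, 'v) rep \<Rightarrow> nat \<Rightarrow> nat \<Rightarrow> 'v \<Rightarrow> 'v" where
  "transport V n 0 = id"
| "transport V n (Suc k) = vmap V (Vn (n + k), Vn (Suc (n + k))) \<circ> transport V n k"

text \<open>
Only the trivalent vertex has arrows to the leaves. At the other vertices of the leg the composite to
a leaf is regarded as zero, so both leaf kernels are the whole space.
\<close>
definition vertex_data ::
  "(mountain_vertex, mountain_vertex \<times> mountain_vertex, 'v::zero) rep \<Rightarrow> nat \<Rightarrow> 'v kernel_data" where
  "vertex_data V n =
     \<lparr>space = vspace V (Vn n),
      kerl = {y \<in> vspace V (Vn n). n = 0 \<longrightarrow> vmap V (Vn 0, Vu) y = 0},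
      kerr = {y \<in> vspace V (Vn n). n = 0 \<longrightarrow> vmap V (Vn 0, Vu') y = 0},
      kerleg = (\<lambda>k. {y \<in> vspace V (Vn n). transport V n k y = 0})\<rparr>"

definition surjective_from ::
  "(mountain_vertex, mountain_vertex \<times> mountain_vertex, 'v) rep \<Rightarrow> nat \<Rightarrow> bool" where
  "surjective_from V n \<longleftrightarrow> (\<forall>k. transport V n k ` vspace V (Vn n) = vspace V (Vn (n + k))) \<and>
     (n = 0 \<longrightarrow> (\<forall>w\<in>{Vu, Vu'}. vmap V (Vn 0, w) ` vspace V (Vn 0) = vspace V w))"

definition zero_before ::
  "(mountain_vertex, mountain_vertex \<times> mountain_vertex, 'v::zero) rep \<Rightarrow> nat \<Rightarrow> bool" where
  "zero_before V n \<longleftrightarrow> (\<forall>i<n. vspace V (Vn i) = {0}) \<and>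
     (n > 0 \<longrightarrow> (\<forall>w\<in>{Vu, Vu'}. vspace V w = {0}))"

definition simple_at_leaf ::
  "(mountain_vertex, 'e, 'v::zero) rep \<Rightarrow> mountain_vertex \<Rightarrow> bool" where
  "simple_at_leaf V w \<longleftrightarrow> w \<in> {Vu, Vu'} \<and> (\<forall>i. i \<noteq> w \<longrightarrow> vspace V i = {0})"

context scaled_space
begin

lemma linear_betweenD:
  assumes "linear_between scale S T f"
  shows "y \<in> S \<Longrightarrow> f y \<in> T"
    and "\<lbrakk>y \<in> S; z \<in> S\<rbrakk> \<Longrightarrow> f (y + z) = f y + f z"
    and "y \<in> S \<Longrightarrow> f (c *s y) = c *s f y"
  using assms by (auto simp: linear_between_def)

lemma linear_between_0:
  assumes "linear_between scale S T f" "subspace S"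
  shows "f 0 = 0"
  using linear_betweenD(3)[OF assms(1), of 0 0] subspace_0[OF assms(2)] by simp

lemma linear_between_diff:
  assumes f: "linear_between scale S T f" "subspace S" and yz: "y \<in> S" "z \<in> S"
  shows "f (y - z) = f y - f z"
proof -
  have "f (y - z + z) = f (y - z) + f z"
    by (rule linear_betweenD(2)[OF f(1)]) (use f yz subspace_diff in auto)
  then show ?thesis by (simp add: eq_diff_eq)
qed

lemma linear_between_kernel:
  assumes "linear_between scale S T f" "subspace S"
  shows "subspace {y \<in> S. f y = 0}"
  using linear_betweenD[OF assms(1)] linear_between_0[OF assms] assms(2)
  by (auto simp: subspace_def)

lemma linear_between_image:
  assumes f: "linear_between scale S T f" "subspace S"
  shows "subspace (f ` S)"
proof (rule subspaceI)
  show "0 \<in> f ` S" using linear_between_0[OF f] subspace_0[OF f(2)] by force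
  fix y z assume "y \<in> f ` S" "z \<in> f ` S"
  then obtain u v where uv: "u \<in> S" "v \<in> S" "y = f u" "z = f v" by blast
  then have "y + z = f (u + v)" by (simp add: linear_betweenD(2)[OF f(1)])
  then show "y + z \<in> f ` S" using subspace_add[OF f(2)] uv by blast
next
  show "c *s y \<in> f ` S" if "y \<in> f ` S" for c y
    using that linear_betweenD(3)[OF f(1)] f(2) by (metis (no_types, lifting) imageE imageI subspace_scale)
qed

text \<open>
The image and the kernel of \<open>e\<close> are complementary subrepresentations.
\<close>
lemma idempotent_endomorphism_trivial:
  assumes Q: "wf_digraph Q" and V: "quiver_rep scale Q V" and indec: "indecomposable scale Q V"
    and e: "morphism scale Q V V e"
    and idem: "\<And>i y. \<lbrakk>i \<in> verts Q; y \<in> vspace V i\<rbrakk> \<Longrightarrow> e i (e i y) = e i y"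
  shows "(\<forall>i\<in>verts Q. \<forall>y\<in>vspace V i. e i y = 0) \<or> (\<forall>i\<in>verts Q. \<forall>y\<in>vspace V i. e i y = y)"
proof -
  interpret wf_digraph Q by (rule Q)
  define X where "X = \<lparr>vspace = (\<lambda>i. e i ` vspace V i), vmap = vmap V\<rparr>"
  define Y where "Y = \<lparr>vspace = (\<lambda>i. {y \<in> vspace V i. e i y = 0}), vmap = vmap V\<rparr>"
  have sub: "subspace (vspace V i)" and lin: "linear_between scale (vspace V i) (vspace V i) (e i)"
    if "i \<in> verts Q" for i
    using V e that by (auto simp: quiver_rep_def morphism_def)
  have vlin: "linear_between scale (vspace V (tail Q a)) (vspace V (head Q a)) (vmap V a)"
    and comm: "x \<in> vspace V (tail Q a) \<Longrightarrow> e (head Q a) (vmap V a x) = vmap V a (e (tail Q a) x)"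
    if "a \<in> arcs Q" for a x
    using V e that by (auto simp: quiver_rep_def morphism_def)
  have restrict: "linear_between scale S T f" if "linear_between scale S' T' f" "S \<subseteq> S'" "f ` S \<subseteq> T"
    for S S' T T' f
    using that unfolding linear_between_def by blast
  have eV: "e i ` vspace V i \<subseteq> vspace V i" if "i \<in> verts Q" for i
    using linear_betweenD(1)[OF lin[OF that]] by auto
  have "subrep scale Q X V"
    unfolding subrep_def quiver_rep_def
  proof (intro conjI ballI)
    fix i assume "i \<in> verts Q"
    then show "subspace (vspace X i)" "vspace X i \<subseteq> vspace V i"
      using linear_between_image[OF lin sub] eV by (auto simp: X_def)
  next
    fix a assume a: "a \<in> arcs Q"
    have "vmap V a ` (e (tail Q a) ` vspace V (tail Q a)) \<subseteq> e (head Q a) ` vspace V (head Q a)"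
      using comm[OF a, symmetric] linear_betweenD(1)[OF vlin[OF a]] by (auto simp: image_image)
    then show "linear_between scale (vspace X (tail Q a)) (vspace X (head Q a)) (vmap X a)"
      using restrict[OF vlin[OF a]] eV a by (simp add: X_def)
  qed (simp add: X_def)
  moreover have "subrep scale Q Y V"
    unfolding subrep_def quiver_rep_def
  proof (intro conjI ballI)
    fix i assume "i \<in> verts Q"
    then show "subspace (vspace Y i)" "vspace Y i \<subseteq> vspace V i"
      using linear_between_kernel[OF lin sub] by (auto simp: Y_def)
  next
    fix a assume a: "a \<in> arcs Q"
    have "vmap V a 0 = 0" using linear_between_0[OF vlin sub] a by simp
    then have "vmap V a ` vspace Y (tail Q a) \<subseteq> vspace Y (head Q a)"
      using comm[OF a] linear_betweenD(1)[OF vlin[OF a]] by (auto simp: Y_def)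
    then show "linear_between scale (vspace Y (tail Q a)) (vspace Y (head Q a)) (vmap Y a)"
      using restrict[OF vlin[OF a]] by (auto simp: Y_def)
  qed (simp add: Y_def)
  moreover have "vspace X i \<inter> vspace Y i = {0} \<and>
      vspace V i = {x + y |x y. x \<in> vspace X i \<and> y \<in> vspace Y i}" if i: "i \<in> verts Q" for i
  proof
    have e0: "e i 0 = 0" using linear_between_0[OF lin sub] i by simp
    then have "0 \<in> e i ` vspace V i" using subspace_0[OF sub[OF i]] by force
    then show "vspace X i \<inter> vspace Y i = {0}"
      using idem[OF i] e0 subspace_0[OF sub[OF i]] by (auto simp: X_def Y_def)
    have "y \<in> {x + y |x y. x \<in> vspace X i \<and> y \<in> vspace Y i}" if y: "y \<in> vspace V i" for y
    proof -
      have "e i y \<in> vspace V i" using eV[OF i] y by auto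
      then have "y - e i y \<in> vspace Y i"
        using linear_between_diff[OF lin sub] i y idem[OF i y] subspace_diff[OF sub[OF i]]
        by (simp add: Y_def)
      moreover have "e i y \<in> vspace X i" using y by (simp add: X_def)
      moreover have "y = e i y + (y - e i y)" by simp
      ultimately show ?thesis by blast
    qed
    moreover have "{x + y |x y. x \<in> vspace X i \<and> y \<in> vspace Y i} \<subseteq> vspace V i"
      using subspace_add[OF sub[OF i]] eV[OF i] by (auto simp: X_def Y_def)
    ultimately show "vspace V i = {x + y |x y. x \<in> vspace X i \<and> y \<in> vspace Y i}" by blast
  qed
  ultimately have "zero_rep Q X \<or> zero_rep Q Y"
    using indec unfolding indecomposable_def direct_sum_of_def by blast
  then show ?thesis
  proof
    assume "zero_rep Q X"
    then show ?thesis unfolding zero_rep_def X_def by auto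
  next
    assume Y: "zero_rep Q Y"
    have "e i y = y" if i: "i \<in> verts Q" and y: "y \<in> vspace V i" for i y
    proof -
      have "e i y \<in> vspace V i" using eV[OF i] y by auto
      then have "y - e i y \<in> vspace Y i"
        using linear_between_diff[OF lin sub] i y idem[OF i y] subspace_diff[OF sub[OF i]]
        by (simp add: Y_def)
      then have "y - e i y = 0" using Y i unfolding zero_rep_def by blast
      then show ?thesis by simp
    qed
    then show ?thesis by blast
  qed
qed

lemma endomorphism_descends:
  assumes U: "subspace U" and T: "linear_between scale U Y T" "T ` U = Y"
    and e: "linear_between scale U U e" and ker: "\<And>y. \<lbrakk>y \<in> U; T y = 0\<rbrakk> \<Longrightarrow> T (e y) = 0"
  obtains e' where "linear_between scale Y Y e'" "\<And>y. y \<in> U \<Longrightarrow> e' (T y) = T (e y)"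
proof -
  define e' where "e' = (\<lambda>z. T (e (SOME y. y \<in> U \<and> T y = z)))"
  have e': "e' (T y) = T (e y)" if y: "y \<in> U" for y
  proof -
    define z where "z = (SOME z. z \<in> U \<and> T z = T y)"
    have z: "z \<in> U" "T z = T y"
      using someI[of "\<lambda>z. z \<in> U \<and> T z = T y" y] y unfolding z_def by auto
    then have "T (e (z - y)) = 0"
      using ker[of "z - y"] linear_between_diff[OF T(1) U z(1) y] subspace_diff[OF U] y by simp
    moreover have "e (z - y) = e z - e y" by (rule linear_between_diff[OF e U z(1) y])
    ultimately have "T (e z) = T (e y)"
      using linear_between_diff[OF T(1) U, of "e z" "e y"] linear_betweenD(1)[OF e] z y by simp
    then show ?thesis by (simp add: e'_def z_def)
  qed
  have "linear_between scale Y Y e'"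
    unfolding linear_between_def
  proof (intro conjI ballI allI)
    show "e' ` Y \<subseteq> Y"
      using e' T(2) linear_betweenD(1)[OF e] by auto
  next
    fix x y assume "x \<in> Y" "y \<in> Y"
    then obtain u v where uv: "u \<in> U" "v \<in> U" "x = T u" "y = T v" using T(2) by blast
    then have "e' (T (u + v)) = T (e u) + T (e v)"
      using e'[of "u + v"] linear_betweenD[OF e] linear_betweenD[OF T(1)] subspace_add[OF U] by simp
    then show "e' (x + y) = e' x + e' y"
      using uv e' linear_betweenD(2)[OF T(1)] by simp
  next
    fix c x assume "x \<in> Y"
    then obtain u where u: "u \<in> U" "x = T u" using T(2) by blast
    then have "e' (T (c *s u)) = c *s T (e u)"
      using e'[of "c *s u"] linear_betweenD[OF e] linear_betweenD[OF T(1)] subspace_scale[OF U] by simp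
    then show "e' (c *s x) = c *s e' x"
      using u e' linear_betweenD(3)[OF T(1)] by simp
  qed
  with e' that show thesis by blast
qed

text \<open>
If \<open>g\<close> is a bijection that matches the kernels of two surjections, then the map it induces on the
quotients is a bijection. This is how an isomorphism of configurations becomes one of
representations.
\<close>
lemma bijection_descends:
  assumes U: "subspace U" and T: "linear_between scale U Y T" "T ` U = Y"
    and U': "subspace U'" and T': "T' ` U' = Y'"
    and g: "inj_on g U" "g ` U = U'" "g ` {y \<in> U. T y = 0} = {y \<in> U'. T' y = 0}"
    and h: "linear_between scale Y Y' h" "\<And>y. y \<in> U \<Longrightarrow> h (T y) = T' (g y)"
  shows "bij_betw h Y Y'"
proof -
  have Y: "subspace Y" using linear_between_image[OF T(1) U] T(2) by simp
  have ker: "T y = 0" if y: "y \<in> U" "T' (g y) = 0" for y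
  proof -
    have "g y \<in> g ` {y \<in> U. T y = 0}" using y g by auto
    then show ?thesis using g(1) y(1) by (auto dest: inj_onD)
  qed
  have "inj_on h Y"
  proof (rule inj_onI)
    fix x y assume xy: "x \<in> Y" "y \<in> Y" "h x = h y"
    then have "h (x - y) = 0" using linear_between_diff[OF h(1) Y] by simp
    moreover have "x - y \<in> Y" using subspace_diff[OF Y] xy by simp
    ultimately obtain u where "u \<in> U" "x - y = T u" "T' (g u) = 0" using T(2) h(2) by (metis imageE)
    then show "x = y" using ker by simp
  qed
  moreover have "h ` Y = Y'"
  proof -
    have "h ` Y = (\<lambda>y. T' (g y)) ` U" using T(2) h(2) by (metis (no_types, lifting) image_cong image_image)
    also have "\<dots> = Y'" using g(2) T' by (metis image_image)
    finally show ?thesis .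
  qed
  ultimately show ?thesis by (simp add: bij_betw_def)
qed

context
  fixes V :: "(mountain_vertex, mountain_vertex \<times> mountain_vertex, 'v) rep"
  assumes V: "quiver_rep scale D_inf_mountain V"
begin

lemma rep_subspace: "subspace (vspace V i)"
  using V by (simp add: quiver_rep_def)

lemma rep_linear_leaf: "w \<in> {Vu, Vu'} \<Longrightarrow>
    linear_between scale (vspace V (Vn 0)) (vspace V w) (vmap V (Vn 0, w))"
  and rep_linear_leg: "linear_between scale (vspace V (Vn j)) (vspace V (Vn (Suc j))) (vmap V (Vn j, Vn (Suc j)))"
  using V by (auto simp: quiver_rep_def ball_arcs_mountain)

lemma rep_linear_transport:
  "linear_between scale (vspace V (Vn n)) (vspace V (Vn (n + k))) (transport V n k)"
proof (induction k)
  case (Suc k)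
  note IH = linear_betweenD[OF Suc] and leg = linear_betweenD[OF rep_linear_leg[of "n + k"]]
  show ?case by (auto simp: linear_between_def IH leg)
qed (simp add: linear_between_def)

lemma vertex_data_wf: "kernel_data_wf (vertex_data V n)"
proof -
  have "mono (\<lambda>k. {y \<in> vspace V (Vn n). transport V n k y = 0})"
    by (rule monoI, erule lift_Suc_mono_le[rotated])
       (auto simp: linear_between_0[OF rep_linear_leg rep_subspace])
  moreover have "subspace {y \<in> vspace V (Vn n). n = 0 \<longrightarrow> vmap V (Vn 0, w) y = 0}"
    if "w \<in> {Vu, Vu'}" for w
    using linear_between_kernel[OF rep_linear_leaf[OF that] rep_subspace] rep_subspace by (cases "n = 0") auto
  ultimately show ?thesis
    unfolding kernel_data_wf_def vertex_data_def
    using rep_subspace linear_between_kernel[OF rep_linear_transport rep_subspace] subspace_0[OF rep_subspace]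
    by auto
qed

text \<open>
Behind \<open>n\<close> all spaces are quotients of the space at \<open>n\<close>, so \<open>e\<close> induces maps there. Everywhere else
\<open>E\<close> is zero; the assumption \<open>prev\<close> makes this compatible with the arrow that ends in \<open>n\<close>.
\<close>
lemma extend_idempotent:
  assumes surj: "surjective_from V n"
    and e: "data_map (vertex_data V n) (vertex_data V n) e"
    and idem: "\<And>y. y \<in> vspace V (Vn n) \<Longrightarrow> e (e y) = e y"
    and prev: "\<And>j y. \<lbrakk>n = Suc j; y \<in> vspace V (Vn j)\<rbrakk> \<Longrightarrow> e (vmap V (Vn j, Vn n) y) = 0"
  obtains E where "morphism scale D_inf_mountain V V E"
    "\<And>i y. y \<in> vspace V i \<Longrightarrow> E i (E i y) = E i y"
    "\<And>y. y \<in> vspace V (Vn n) \<Longrightarrow> E (Vn n) y = e y"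
    "\<And>i y. i < n \<Longrightarrow> E (Vn i) y = 0" "\<And>w y. \<lbrakk>0 < n; w \<in> {Vu, Vu'}\<rbrakk> \<Longrightarrow> E w y = 0"
proof -
  have e_lin: "linear_between scale (vspace V (Vn n)) (vspace V (Vn n)) e"
    and e_leaf: "\<lbrakk>w \<in> {Vu, Vu'}; n = 0; y \<in> vspace V (Vn 0); vmap V (Vn 0, w) y = 0\<rbrakk>
      \<Longrightarrow> vmap V (Vn 0, w) (e y) = 0"
    and e_leg: "\<lbrakk>y \<in> vspace V (Vn n); transport V n k y = 0\<rbrakk> \<Longrightarrow> transport V n k (e y) = 0" for w y k
    using e by (auto simp: data_map_def vertex_data_def image_subset_iff)
  have "\<exists>e'. linear_between scale (vspace V (Vn (n + k))) (vspace V (Vn (n + k))) e' \<and>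
      (\<forall>y\<in>vspace V (Vn n). e' (transport V n k y) = transport V n k (e y))" for k
    using endomorphism_descends[OF rep_subspace rep_linear_transport _ e_lin e_leg, of k] surj
    unfolding surjective_from_def by metis
  from choice[OF allI, OF this] obtain L where L_all: "\<forall>k. linear_between scale (vspace V (Vn (n + k))) (vspace V (Vn (n + k))) (L k) \<and>
      (\<forall>y\<in>vspace V (Vn n). L k (transport V n k y) = transport V n k (e y))"
    ..
  then have L: "linear_between scale (vspace V (Vn (n + k))) (vspace V (Vn (n + k))) (L k)"
    "y \<in> vspace V (Vn n) \<Longrightarrow> L k (transport V n k y) = transport V n k (e y)" for k y
    by auto
  have "\<exists>e'. n = 0 \<and> w \<in> {Vu, Vu'} \<longrightarrow> linear_between scale (vspace V w) (vspace V w) e' \<and>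
      (\<forall>y\<in>vspace V (Vn n). e' (vmap V (Vn 0, w) y) = vmap V (Vn 0, w) (e y))" for w
  proof (cases "n = 0 \<and> w \<in> {Vu, Vu'}")
    case True
    then have w: "w \<in> {Vu, Vu'}" and n: "n = 0" by auto
    show ?thesis
      using endomorphism_descends[OF rep_subspace rep_linear_leaf[OF w] _ e_lin[unfolded n] e_leaf[OF w n]] surj w n
      unfolding surjective_from_def by metis
  qed auto
  from choice[OF allI, OF this] obtain M where M_all: "\<forall>w. n = 0 \<and> w \<in> {Vu, Vu'} \<longrightarrow>
      linear_between scale (vspace V w) (vspace V w) (M w) \<and>
      (\<forall>y\<in>vspace V (Vn n). M w (vmap V (Vn 0, w) y) = vmap V (Vn 0, w) (e y))" ..
  then have M: "\<lbrakk>n = 0; w \<in> {Vu, Vu'}\<rbrakk> \<Longrightarrow> linear_between scale (vspace V w) (vspace V w) (M w)"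
    "\<lbrakk>n = 0; w \<in> {Vu, Vu'}; y \<in> vspace V (Vn n)\<rbrakk> \<Longrightarrow> M w (vmap V (Vn 0, w) y) = vmap V (Vn 0, w) (e y)" for w y
    by auto
  define E where "E = (\<lambda>i. case i of Vn j \<Rightarrow> if j < n then (\<lambda>_. 0) else L (j - n)
     | _ \<Rightarrow> if n = 0 then M i else (\<lambda>_. 0))"
  have E_leg: "E (Vn (n + k)) = L k" and E_before: "j < n \<Longrightarrow> E (Vn j) = (\<lambda>_. 0)"
    and E_leaf: "\<lbrakk>n = 0; w \<in> {Vu, Vu'}\<rbrakk> \<Longrightarrow> E w = M w"
    and E_leaf0: "\<lbrakk>0 < n; w \<in> {Vu, Vu'}\<rbrakk> \<Longrightarrow> E w = (\<lambda>_. 0)" for k j w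
    by (auto simp: E_def)
  have E_n: "E (Vn n) y = e y" if "y \<in> vspace V (Vn n)" for y
    using E_leg[of 0] L(2)[OF that, of 0] by simp
  have zero_lin: "linear_between scale (vspace V i) (vspace V i) (\<lambda>_. 0)" for i
    using subspace_0[OF rep_subspace] by (auto simp: linear_between_def)
  have vertex_cases: "(\<exists>w\<in>{Vu, Vu'}. i = w) \<or> (\<exists>j<n. i = Vn j) \<or> (\<exists>k. i = Vn (n + k))" for i
    by (cases i) (auto, metis le_add_diff_inverse not_le)
  have "linear_between scale (vspace V i) (vspace V i) (E i)" for i
  proof -
    consider w where "w \<in> {Vu, Vu'}" "i = w" "n = 0" | "E i = (\<lambda>_. 0)" | k where "i = Vn (n + k)"
      using vertex_cases[of i] E_before E_leaf0 by (metis gr0I)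
    then show ?thesis
      by cases (use L(1) M(1) zero_lin E_leg E_leaf in auto)
  qed
  moreover have "E (Vn (Suc j)) (vmap V (Vn j, Vn (Suc j)) y) = vmap V (Vn j, Vn (Suc j)) (E (Vn j) y)"
    if y: "y \<in> vspace V (Vn j)" for j y
  proof -
    consider "Suc j < n" | "Suc j = n" | k where "j = n + k"
      by (metis le_add_diff_inverse less_Suc_eq_le not_less_eq_eq linorder_neqE_nat)
    then show ?thesis
    proof cases
      case 3
      then obtain u where u: "u \<in> vspace V (Vn n)" "y = transport V n k u"
        using surj y unfolding surjective_from_def by blast
      then have "E (Vn (Suc j)) (vmap V (Vn j, Vn (Suc j)) y) = transport V n (Suc k) (e u)"
        using L(2)[OF u(1), of "Suc k"] E_leg[of "Suc k"] 3 by simp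
      moreover have "E (Vn j) y = transport V n k (e u)"
        using L(2)[OF u(1), of k] E_leg[of k] 3 u by simp
      ultimately show ?thesis using 3 by simp
    next
      case 2
      then show ?thesis
        using E_n[of "vmap V (Vn j, Vn n) y"] prev[OF _ y] E_before[of j]
          linear_betweenD(1)[OF rep_linear_leg y] linear_between_0[OF rep_linear_leg rep_subspace] by auto
    qed (simp add: E_before linear_between_0[OF rep_linear_leg rep_subspace])
  qed
  moreover have "E w (vmap V (Vn 0, w) y) = vmap V (Vn 0, w) (E (Vn 0) y)"
    if w: "w \<in> {Vu, Vu'}" and y: "y \<in> vspace V (Vn 0)" for w y
  proof (cases "n = 0")
    case True
    then show ?thesis using E_leaf[OF True w] M(2)[OF True w] E_n y by simp
  next
    case False
    then show ?thesis using E_leaf0[OF _ w] E_before[of 0] linear_between_0[OF rep_linear_leaf[OF w] rep_subspace] by simp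
  qed
  ultimately have "morphism scale D_inf_mountain V V E"
    by (simp add: morphism_def ball_arcs_mountain)
  moreover have "E i (E i y) = E i y" if y: "y \<in> vspace V i" for i y
  proof -
    have e_in: "u \<in> vspace V (Vn n) \<Longrightarrow> e u \<in> vspace V (Vn n)" for u
      by (rule linear_betweenD(1)[OF e_lin])
    consider w where "w \<in> {Vu, Vu'}" "i = w" "n = 0" | "E i = (\<lambda>_. 0)" | k where "i = Vn (n + k)"
      using vertex_cases[of i] E_before E_leaf0 by (metis gr0I)
    then show ?thesis
    proof cases
      case (1 w)
      then obtain u where u: "u \<in> vspace V (Vn n)" "y = vmap V (Vn 0, w) u"
        using surj y unfolding surjective_from_def by blast
      then show ?thesis using M(2)[OF 1(3,1)] E_leaf[OF 1(3,1)] 1 e_in idem by simp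
    next
      case (3 k)
      then obtain u where u: "u \<in> vspace V (Vn n)" "y = transport V n k u"
        using surj y unfolding surjective_from_def by blast
      then show ?thesis using L(2) E_leg 3 e_in idem by simp
    qed simp
  qed
  ultimately show thesis using that E_n E_before E_leaf0 by (metis (no_types, lifting))
qed

end

section \<open>The indecomposable FLEI representations\<close>

lemma surjective_fromD:
  assumes "surjective_from V n"
  shows "transport V n k ` vspace V (Vn n) = vspace V (Vn (n + k))"
    and "\<lbrakk>n = 0; w \<in> {Vu, Vu'}\<rbrakk> \<Longrightarrow> vmap V (Vn 0, w) ` vspace V (Vn 0) = vspace V w"
  using assms unfolding surjective_from_def by auto

definition root_at :: "(mountain_vertex, mountain_vertex \<times> mountain_vertex, 'v) rep \<Rightarrow> nat \<Rightarrow> bool" where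
  "root_at V n \<longleftrightarrow> zero_before V n \<and> surjective_from V n \<and> vspace V (Vn n) \<noteq> {0} \<and>
     root_data (vertex_data V n)"

context
  fixes V :: "(mountain_vertex, mountain_vertex \<times> mountain_vertex, 'v) rep"
  assumes V: "quiver_rep scale D_inf_mountain V"
    and indec: "indecomposable scale D_inf_mountain V"
begin

text \<open>
The extension of \<open>e\<close> is zero before \<open>n\<close>. So if it is the identity of the representation, then the
representation vanishes before \<open>n\<close>.
\<close>
lemma idempotent_at_vertex_trivial:
  assumes surj: "surjective_from V n"
    and e: "data_map (vertex_data V n) (vertex_data V n) e"
    and idem: "\<And>y. y \<in> vspace V (Vn n) \<Longrightarrow> e (e y) = e y"
    and prev: "\<And>j y. \<lbrakk>n = Suc j; y \<in> vspace V (Vn j)\<rbrakk> \<Longrightarrow> e (vmap V (Vn j, Vn n) y) = 0"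
  shows "(\<forall>y\<in>vspace V (Vn n). e y = 0) \<or> (\<forall>y\<in>vspace V (Vn n). e y = y) \<and> zero_before V n"
proof -
  obtain E where E: "morphism scale D_inf_mountain V V E"
    "\<And>i y. y \<in> vspace V i \<Longrightarrow> E i (E i y) = E i y"
    "\<And>y. y \<in> vspace V (Vn n) \<Longrightarrow> E (Vn n) y = e y"
    "\<And>i y. i < n \<Longrightarrow> E (Vn i) y = 0" "\<And>w y. \<lbrakk>0 < n; w \<in> {Vu, Vu'}\<rbrakk> \<Longrightarrow> E w y = 0"
    using extend_idempotent[OF V surj e idem prev] by blast
  consider "\<And>i y. y \<in> vspace V i \<Longrightarrow> E i y = 0" | "\<And>i y. y \<in> vspace V i \<Longrightarrow> E i y = y"
    using idempotent_endomorphism_trivial[OF wf_mountain V indec E(1) E(2)] by auto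
  then show ?thesis
  proof cases
    case 1
    then show ?thesis using E(3) by metis
  next
    case 2
    have "vspace V i = {0}" if "\<And>y. E i y = 0" for i
      using 2[of _ i] that subspace_0[OF rep_subspace[OF V]] by auto
    then have "zero_before V n"
      unfolding zero_before_def using E(4,5) by blast
    then show ?thesis using 2 E(3) by metis
  qed
qed

text \<open>
A leaf is a sink: a line in its space that avoids the image of the incoming arrow is a direct summand.
\<close>
lemma simple_if_not_onto_leaf:
  assumes w: "w \<in> {Vu, Vu'}" and not_onto: "vmap V (Vn 0, w) ` vspace V (Vn 0) \<noteq> vspace V w"
  shows "simple_at_leaf V w \<and> (\<exists>x. x \<noteq> 0 \<and> vspace V w = span {x})"
proof -
  let ?im = "vmap V (Vn 0, w) ` vspace V (Vn 0)"
  note lin = rep_linear_leaf[OF V w]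
  have im: "subspace ?im" "?im \<subseteq> vspace V w"
    using linear_between_image[OF lin rep_subspace[OF V]] linear_betweenD(1)[OF lin] by auto
  then obtain x where x: "x \<in> vspace V w" "x \<notin> ?im" using not_onto by blast
  obtain e where e: "linear_between scale (vspace V w) (vspace V w) e" "\<And>y. y \<in> ?im \<Longrightarrow> e y = 0"
    "\<And>y. e (e y) = e y" "e x = x" "\<And>y. e y \<in> span {x}"
    using rank_one_projection[OF im(1) rep_subspace[OF V] x] by blast
  have "x \<noteq> 0" using x subspace_0[OF im(1)] by blast
  define E where "E = (\<lambda>i. if i = w then e else (\<lambda>_. 0))"
  have "linear_between scale (vspace V i) (vspace V i) (E i)" for i
    using e(1) subspace_0[OF rep_subspace[OF V]] by (auto simp: E_def linear_between_def)
  moreover have "vmap V (Vn 0, w') 0 = 0" if "w' \<in> {Vu, Vu'}" for w'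
    by (rule linear_between_0[OF rep_linear_leaf[OF V that] rep_subspace[OF V]])
  moreover have "vmap V (Vn j, Vn (Suc j)) 0 = 0" for j
    by (rule linear_between_0[OF rep_linear_leg[OF V] rep_subspace[OF V]])
  ultimately have "morphism scale D_inf_mountain V V E"
    using e(2) w by (auto simp: morphism_def ball_arcs_mountain E_def)
  moreover have "E i (E i y) = E i y" for i y by (simp add: E_def e(3))
  ultimately have "(\<forall>i. \<forall>y\<in>vspace V i. E i y = 0) \<or> (\<forall>i. \<forall>y\<in>vspace V i. E i y = y)"
    using idempotent_endomorphism_trivial[OF wf_mountain V indec, of E] by simp
  then consider "\<And>i y. y \<in> vspace V i \<Longrightarrow> E i y = 0" | "\<And>i y. y \<in> vspace V i \<Longrightarrow> E i y = y"
    by blast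
  then show ?thesis
  proof cases
    case 1
    then show ?thesis using 1[of x w] x e(4) \<open>x \<noteq> 0\<close> by (simp add: E_def)
  next
    case 2
    have "vspace V i = {0}" if "i \<noteq> w" for i
      using 2[of _ i] that subspace_0[OF rep_subspace[OF V]] by (auto simp: E_def)
    moreover have "vspace V w \<subseteq> span {x}"
      using 2[of _ w] e(5) by (metis E_def subsetI)
    then have "vspace V w = span {x}"
      using x(1) rep_subspace[OF V] by (simp add: span_minimal subset_antisym)
    ultimately show ?thesis using w \<open>x \<noteq> 0\<close> by (auto simp: simple_at_leaf_def)
  qed
qed

lemma root_at_0:
  assumes "surjective_from V 0"
  shows "root_at V 0"
proof -
  have "trivial_idempotents (vertex_data V 0)"
    unfolding trivial_idempotents_def
    using idempotent_at_vertex_trivial[OF assms] by (auto simp: vertex_data_def)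
  moreover have nz: "vspace V (Vn 0) \<noteq> {0}"
  proof
    assume 0: "vspace V (Vn 0) = {0}"
    have "vspace V i = {0}" for i
    proof (cases i)
      case (Vn k)
      have "transport V 0 k 0 = 0"
        by (rule linear_between_0[OF rep_linear_transport[OF V] rep_subspace[OF V]])
      then show ?thesis
        using assms 0 Vn unfolding surjective_from_def by (metis add_0 image_empty image_insert)
    next
      case Vu
      have "vmap V (Vn 0, Vu) 0 = 0"
        by (rule linear_between_0[OF rep_linear_leaf[OF V] rep_subspace[OF V]]) simp
      then show ?thesis
        using assms 0 Vu unfolding surjective_from_def by (metis image_empty image_insert insertI1)
    next
      case Vu'
      have "vmap V (Vn 0, Vu') 0 = 0"
        by (rule linear_between_0[OF rep_linear_leaf[OF V] rep_subspace[OF V]]) simp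
      then show ?thesis
        using assms 0 Vu' unfolding surjective_from_def by (metis image_empty image_insert insertI1 insertI2)
    qed
    then show False using indec by (simp add: indecomposable_def zero_rep_def)
  qed
  moreover have "space (vertex_data V 0) = vspace V (Vn 0)" by (simp add: vertex_data_def)
  ultimately show ?thesis
    using thin_or_planar[OF vertex_data_wf[OF V], of 0] assms vertex_data_wf[OF V]
    by (simp add: root_at_def root_data_def zero_before_def)
qed

text \<open>
A vector \<open>x\<close> outside the image of the incoming arrow starts a direct summand, provided that it is
chosen to die as early as possible along the leg. Then each kernel of the leg either lies in that
image or contains \<open>x\<close>, so the projection onto \<open>\<langle>x\<rangle>\<close> that kills the image preserves all kernels.
\<close>
lemma root_at_Suc:
  assumes surj: "surjective_from V (Suc j)"
    and not_onto: "vmap V (Vn j, Vn (Suc j)) ` vspace V (Vn j) \<noteq> vspace V (Vn (Suc j))"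
  shows "root_at V (Suc j)"
proof -
  let ?U = "vspace V (Vn (Suc j))" and ?D = "vertex_data V (Suc j)"
  let ?im = "vmap V (Vn j, Vn (Suc j)) ` vspace V (Vn j)"
  note lin = rep_linear_leg[OF V, of j]
  have im: "subspace ?im" "?im \<subseteq> ?U"
    using linear_between_image[OF lin rep_subspace[OF V]] linear_betweenD(1)[OF lin] by auto
  have wf: "kernel_data_wf ?D" by (rule vertex_data_wf[OF V])
  have D: "space ?D = ?U" "kerl ?D = ?U" "kerr ?D = ?U" by (simp_all add: vertex_data_def)
  have leg: "subspace (kerleg ?D k)" "kerleg ?D k \<subseteq> ?U" for k
    using wf D(1) by (auto simp: kernel_data_wf_def)
  obtain x where x: "x \<in> ?U" "x \<notin> ?im" and x_leg: "\<And>k. kerleg ?D k \<subseteq> ?im \<or> x \<in> kerleg ?D k"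
  proof (cases "\<exists>k. \<not> kerleg ?D k \<subseteq> ?im")
    case True
    define k0 where "k0 = (LEAST k. \<not> kerleg ?D k \<subseteq> ?im)"
    have "\<not> kerleg ?D k0 \<subseteq> ?im" unfolding k0_def using True by (rule LeastI_ex)
    then obtain x where "x \<in> kerleg ?D k0" "x \<notin> ?im" by blast
    moreover have "kerleg ?D k \<subseteq> ?im \<or> kerleg ?D k0 \<subseteq> kerleg ?D k" for k
      using wf Least_le[of "\<lambda>k. \<not> kerleg ?D k \<subseteq> ?im" k]
      unfolding k0_def kernel_data_wf_def by (meson monoD)
    ultimately show thesis using that leg by blast
  qed (use not_onto im that in blast)
  obtain e where e: "linear_between scale ?U ?U e" "\<And>y. y \<in> ?im \<Longrightarrow> e y = 0"
    "\<And>y. e (e y) = e y" "e x = x" "\<And>y. e y \<in> span {x}"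
    using rank_one_projection[OF im(1) rep_subspace[OF V] x] by blast
  have "e ` kerleg ?D k \<subseteq> kerleg ?D k" for k
  proof (cases "x \<in> kerleg ?D k")
    case True
    then have "span {x} \<subseteq> kerleg ?D k" using leg(1) by (simp add: span_minimal)
    then show ?thesis using e(5) by blast
  next
    case False
    then show ?thesis using x_leg[of k] e(2) subspace_0[OF leg(1)] by auto
  qed
  then have "data_map ?D ?D e"
    unfolding data_map_def D using e(1) linear_betweenD(1)[OF e(1)] by auto
  moreover have "x \<noteq> 0" using x subspace_0[OF im(1)] by blast
  ultimately have triv: "\<And>y. y \<in> ?U \<Longrightarrow> e y = y" and zero: "zero_before V (Suc j)"
    using idempotent_at_vertex_trivial[OF surj, of e] e(2-4) x(1) by fastforce+
  have "?U \<subseteq> span {x}" using triv e(5) by (metis subsetI)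
  then have "?U = span {x}" using x(1) rep_subspace[OF V] by (simp add: span_minimal subset_antisym)
  then have "thin ?D" using \<open>x \<noteq> 0\<close> D unfolding thin_def by auto
  then show ?thesis
    unfolding root_at_def root_data_def using wf surj zero x(1) \<open>x \<noteq> 0\<close> by auto
qed

text \<open>
The generating vertex is the head of the last arrow of the leg that is not onto, or the trivalent
vertex if there is none. Finitely many arrows fail to be bijective, so a last one exists.
\<close>
lemma indecomposable_cases:
  assumes flei: "flei scale D_inf_mountain V"
  shows "(\<exists>w x. simple_at_leaf V w \<and> x \<noteq> 0 \<and> vspace V w = span {x}) \<or> (\<exists>n. root_at V n)"
proof (cases "\<exists>w\<in>{Vu, Vu'}. vmap V (Vn 0, w) ` vspace V (Vn 0) \<noteq> vspace V w")
  case True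
  then obtain w where "w \<in> {Vu, Vu'}" "vmap V (Vn 0, w) ` vspace V (Vn 0) \<noteq> vspace V w" by blast
  from simple_if_not_onto_leaf[OF this] show ?thesis by blast
next
  case False
  define J where "J = {j. vmap V (Vn j, Vn (Suc j)) ` vspace V (Vn j) \<noteq> vspace V (Vn (Suc j))}"
  have surj: "surjective_from V n" if "\<And>j. n \<le> j \<Longrightarrow> j \<notin> J" for n
  proof -
    have "transport V n k ` vspace V (Vn n) = vspace V (Vn (n + k))" for k
    proof (induction k)
      case (Suc k)
      have "transport V n (Suc k) ` vspace V (Vn n) =
          vmap V (Vn (n + k), Vn (Suc (n + k))) ` transport V n k ` vspace V (Vn n)"
        by (simp add: image_comp)
      also have "\<dots> = vspace V (Vn (Suc (n + k)))"
        using that[of "n + k"] Suc by (simp add: J_def)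
      finally show ?case by simp
    qed simp
    then show ?thesis using False by (auto simp: surjective_from_def)
  qed
  show ?thesis
  proof (cases "J = {}")
    case True
    then show ?thesis using surj root_at_0 by blast
  next
    case False
    have "(\<lambda>j. (Vn j, Vn (Suc j))) ` J \<subseteq> {a \<in> arcs D_inf_mountain.
        \<not> bij_betw (vmap V a) (vspace V (tail D_inf_mountain a)) (vspace V (head D_inf_mountain a))}"
      by (auto simp: J_def bij_betw_def D_inf_mountain_def)
    then have "finite ((\<lambda>j. (Vn j, Vn (Suc j))) ` J)"
      using flei finite_subset unfolding flei_def by blast
    then have "finite J" by (rule finite_imageD) (simp add: inj_on_def)
    then have J: "Max J \<in> J" "\<And>j. Suc (Max J) \<le> j \<Longrightarrow> j \<notin> J"
      using False Max_ge[of J] by (auto simp: Suc_le_eq leD)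
    then have "root_at V (Suc (Max J))"
      by (intro root_at_Suc surj) (auto simp: J_def)
    then show ?thesis by blast
  qed
qed

end

section \<open>Morphisms decrease a well-founded measure\<close>

lemma transport_natural:
  assumes f: "morphism scale D_inf_mountain V W f"
    and V: "quiver_rep scale D_inf_mountain V" and y: "y \<in> vspace V (Vn n)"
  shows "f (Vn (n + k)) (transport V n k y) = transport W n k (f (Vn n) y)"
proof (induction k)
  case (Suc k)
  have "transport V n k y \<in> vspace V (Vn (n + k))"
    by (rule linear_betweenD(1)[OF rep_linear_transport[OF V] y])
  then show ?case
    using f Suc by (simp add: morphism_def ball_arcs_mountain)
qed simp

lemma morphism_data_map:
  assumes f: "morphism scale D_inf_mountain V W f" and V: "quiver_rep scale D_inf_mountain V"
  shows "data_map (vertex_data V n) (vertex_data W n) (f (Vn n))"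
proof -
  have lin: "linear_between scale (vspace V i) (vspace W i) (f i)" for i
    using f by (simp add: morphism_def)
  have leaf: "f w (vmap V (Vn 0, w) y) = vmap W (Vn 0, w) (f (Vn 0) y)"
    if "w \<in> {Vu, Vu'}" "y \<in> vspace V (Vn 0)" for w y
    using f that by (simp add: morphism_def ball_arcs_mountain) blast
  have f0: "f i 0 = 0" for i using linear_between_0[OF lin rep_subspace[OF V]] .
  show ?thesis
    unfolding data_map_def vertex_data_def kernel_data.simps
  proof (intro conjI allI)
    show "linear_between scale (vspace V (Vn n)) (vspace W (Vn n)) (f (Vn n))" by (rule lin)
    show "f (Vn n) ` {y \<in> vspace V (Vn n). n = 0 \<longrightarrow> vmap V (Vn 0, Vu) y = 0}
        \<subseteq> {y \<in> vspace W (Vn n). n = 0 \<longrightarrow> vmap W (Vn 0, Vu) y = 0}"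
      using linear_betweenD(1)[OF lin] leaf[of Vu] f0 by fastforce
    show "f (Vn n) ` {y \<in> vspace V (Vn n). n = 0 \<longrightarrow> vmap V (Vn 0, Vu') y = 0}
        \<subseteq> {y \<in> vspace W (Vn n). n = 0 \<longrightarrow> vmap W (Vn 0, Vu') y = 0}"
      using linear_betweenD(1)[OF lin] leaf[of Vu'] f0 by fastforce
    show "f (Vn n) ` {y \<in> vspace V (Vn n). transport V n k y = 0}
        \<subseteq> {y \<in> vspace W (Vn n). transport W n k y = 0}" for k
      by (auto simp: transport_natural[OF f V, symmetric] f0 linear_betweenD(1)[OF lin])
  qed
qed

lemma mountain_vertex_cases:
  fixes i :: mountain_vertex and n :: nat
  obtains (leaf) "n = 0" "i \<in> {Vu, Vu'}" | (leg) k where "i = Vn (n + k)"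
    | (before) "(\<exists>j<n. i = Vn j) \<or> 0 < n \<and> i \<in> {Vu, Vu'}"
proof (cases i)
  case (Vn j)
  then show ?thesis using before leg[of "j - n"] by (cases "j < n") auto
qed (use leaf before in auto)

lemma zero_beforeD:
  "zero_before V n \<Longrightarrow> (\<exists>j<n. i = Vn j) \<or> 0 < n \<and> i \<in> {Vu, Vu'} \<Longrightarrow> vspace V i = {0}"
  by (auto simp: zero_before_def)

text \<open>
The representation \<open>V\<close> is generated by its space at \<open>n\<close>.
\<close>
lemma morphism_determined_at_root:
  assumes f: "morphism scale D_inf_mountain V W f" and V: "quiver_rep scale D_inf_mountain V"
    and W: "quiver_rep scale D_inf_mountain W" and n: "root_at V n"
    and 0: "\<And>y. y \<in> vspace V (Vn n) \<Longrightarrow> f (Vn n) y = 0" and y: "y \<in> vspace V i"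
  shows "f i y = 0"
proof -
  have lin: "linear_between scale (vspace V i) (vspace W i) (f i)" for i
    using f by (simp add: morphism_def)
  show ?thesis
  proof (cases rule: mountain_vertex_cases[of n i])
    case leaf
    then obtain u where u: "u \<in> vspace V (Vn 0)" "y = vmap V (Vn 0, i) u"
      using n y unfolding root_at_def surjective_from_def by blast
    then have "f i y = vmap W (Vn 0, i) (f (Vn 0) u)"
      using f leaf by (auto simp: morphism_def ball_arcs_mountain)
    then show ?thesis using 0 u leaf linear_between_0[OF rep_linear_leaf[OF W] rep_subspace[OF W]] by simp
  next
    case (leg k)
    then obtain u where u: "u \<in> vspace V (Vn n)" "y = transport V n k u"
      using n y unfolding root_at_def surjective_from_def by blast
    then show ?thesis
      using transport_natural[OF f V u(1)] 0 leg linear_between_0[OF rep_linear_transport[OF W] rep_subspace[OF W]]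
      by simp
  next
    case before
    then show ?thesis
      using zero_beforeD[of V n i] n y linear_between_0[OF lin rep_subspace[OF V]] by (simp add: root_at_def)
  qed
qed

lemma isomorphism_at_root:
  assumes f: "morphism scale D_inf_mountain V W f" and V: "quiver_rep scale D_inf_mountain V"
    and W: "quiver_rep scale D_inf_mountain W" and nV: "root_at V n" and nW: "root_at W n"
    and iso: "data_iso (vertex_data V n) (vertex_data W n) (f (Vn n))"
  shows "isomorphism scale D_inf_mountain V W f"
proof -
  have lin: "linear_between scale (vspace V i) (vspace W i) (f i)" for i
    using f by (simp add: morphism_def)
  have iso': "inj_on (f (Vn n)) (vspace V (Vn n))"
    "f (Vn n) ` vspace V (Vn n) = vspace W (Vn n)"
    "f (Vn n) ` {y \<in> vspace V (Vn n). n = 0 \<longrightarrow> vmap V (Vn 0, Vu) y = 0} =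
       {y \<in> vspace W (Vn n). n = 0 \<longrightarrow> vmap W (Vn 0, Vu) y = 0}"
    "f (Vn n) ` {y \<in> vspace V (Vn n). n = 0 \<longrightarrow> vmap V (Vn 0, Vu') y = 0} =
       {y \<in> vspace W (Vn n). n = 0 \<longrightarrow> vmap W (Vn 0, Vu') y = 0}"
    "f (Vn n) ` {y \<in> vspace V (Vn n). transport V n k y = 0} =
       {y \<in> vspace W (Vn n). transport W n k y = 0}" for k
    using iso by (simp_all add: data_iso_def vertex_data_def)
  have "bij_betw (f i) (vspace V i) (vspace W i)" for i
  proof (cases rule: mountain_vertex_cases[of n i])
    case leaf
    have surj: "vmap V (Vn 0, i) ` vspace V (Vn 0) = vspace V i"
      "vmap W (Vn 0, i) ` vspace W (Vn 0) = vspace W i"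
      using surjective_fromD(2)[OF _ leaf] nV nW by (metis root_at_def)+
    have "f (Vn 0) ` {y \<in> vspace V (Vn 0). vmap V (Vn 0, i) y = 0} =
        {y \<in> vspace W (Vn 0). vmap W (Vn 0, i) y = 0}"
      using iso'(3,4) leaf by auto
    moreover have "f i (vmap V (Vn 0, i) y) = vmap W (Vn 0, i) (f (Vn 0) y)" if "y \<in> vspace V (Vn 0)" for y
      using f leaf that by (auto simp: morphism_def ball_arcs_mountain)
    ultimately show ?thesis
      using iso'(1,2) leaf(1)
      by (intro bijection_descends[OF rep_subspace[OF V] rep_linear_leaf[OF V leaf(2)] surj(1) rep_subspace[OF W]
          surj(2) _ _ _ lin]) auto
  next
    case (leg k)
    have surj: "transport V n k ` vspace V (Vn n) = vspace V (Vn (n + k))"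
      "transport W n k ` vspace W (Vn n) = vspace W (Vn (n + k))"
      using nV nW by (simp_all add: root_at_def surjective_fromD)
    show ?thesis
      unfolding leg
      by (rule bijection_descends[OF rep_subspace[OF V] rep_linear_transport[OF V] surj(1) rep_subspace[OF W]
          surj(2) iso'(1,2,5) lin transport_natural[OF f V]])
  next
    case before
    then have "vspace V i = {0}" "vspace W i = {0}"
      using zero_beforeD nV nW unfolding root_at_def by blast+
    then show ?thesis using linear_between_0[OF lin[of i] rep_subspace[OF V]] by (simp add: bij_betw_def)
  qed
  then show ?thesis using f by (simp add: isomorphism_def)
qed

text \<open>
The infimum of the empty set makes this \<open>\<infinity>\<close> for the simple representations at the leaves.
\<close>
definition start :: "(mountain_vertex, 'e, 'v) rep \<Rightarrow> enat" where
  "start V = Inf (enat ` {n. vspace V (Vn n) \<noteq> {0}})"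

text \<open>
For a simple representation at a leaf, the configuration is taken at an arbitrary vertex. It never
enters a comparison: such a representation has infinite \<open>start\<close>, and a nonzero map between two of
them is an isomorphism.
\<close>
definition rep_measure ::
  "(mountain_vertex, mountain_vertex \<times> mountain_vertex, 'v) rep \<Rightarrow> enat \<times> nat \<times> enat \<times> enat" where
  "rep_measure V = (start V, data_measure (vertex_data V (the_enat (start V))))"

definition rep_order :: "(enat \<times> nat \<times> enat \<times> enat) rel" where
  "rep_order = {(x, y). x < y} <*lex*> measure_order"

lemma wf_rep_order: "wf rep_order"
  unfolding rep_order_def measure_order_def
  by (intro wf_lex_prod wf wf_less_than)

lemma start_root_at:
  assumes "root_at V n"
  shows "start V = enat n"
proof (rule antisym)
  show "start V \<le> enat n"
    unfolding start_def using assms by (intro Inf_lower) (auto simp: root_at_def)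
  show "enat n \<le> start V"
    unfolding start_def
  proof (rule Inf_greatest)
    fix x assume "x \<in> enat ` {n. vspace V (Vn n) \<noteq> {0}}"
    then obtain m where "x = enat m" "vspace V (Vn m) \<noteq> {0}" by blast
    moreover from this have "\<not> m < n" using assms unfolding root_at_def zero_before_def by blast
    ultimately show "enat n \<le> x" by simp
  qed
qed

lemma start_simple_at_leaf:
  assumes "simple_at_leaf V w"
  shows "start V = \<infinity>"
proof -
  have "{n. vspace V (Vn n) \<noteq> {0}} = {}" using assms by (auto simp: simple_at_leaf_def)
  then show ?thesis by (simp add: start_def Inf_enat_def)
qed

lemma bij_between_lines:
  assumes f: "linear_between scale (span {x}) (span {x'}) f" and nz: "f y \<noteq> 0" "y \<in> span {x}"
  shows "bij_betw f (span {x}) (span {x'})"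
proof -
  note scale_f = linear_betweenD(3)[OF f span_base[OF singletonI]]
  obtain c where "y = c *s x" using nz by (auto simp: span_singleton)
  then have fx: "f x \<noteq> 0" using nz scale_f by auto
  have "inj_on f (span {x})"
  proof (rule inj_onI)
    fix u v assume "u \<in> span {x}" "v \<in> span {x}" "f u = f v"
    then obtain c d where "u = c *s x" "v = d *s x" by (auto simp: span_singleton)
    then show "u = v" using \<open>f u = f v\<close> scale_f fx by simp
  qed
  moreover have "f ` span {x} = span {x'}"
  proof -
    have "f ` span {x} \<noteq> {0}" using nz by blast
    then show ?thesis
      using subspace_of_line[of "f ` span {x}" x'] linear_between_image[OF f subspace_span] linear_betweenD(1)[OF f]
      by blast
  qed
  ultimately show ?thesis by (simp add: bij_betw_def)
qed

text \<open>
If \<open>V\<close> is generated at the vertex \<open>n\<close>, then \<open>f\<close> is nonzero at \<open>n\<close>, so \<open>n\<close> lies in the support of \<open>W\<close>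
and \<open>W\<close> starts at \<open>n\<close> or earlier. If both start at \<open>n\<close>, then \<open>f\<close> induces a nonzero map of
configurations there. The simples at the leaves have infinite \<open>start\<close>, and only such a simple can map
nontrivially to one of them.
\<close>
lemma rep_measure_decreases:
  assumes VF: "V \<in> flei_indecomposables scale D_inf_mountain"
    and WF: "W \<in> flei_indecomposables scale D_inf_mountain"
    and nonzero: "nonzero_morphism scale D_inf_mountain V W f"
    and not_iso: "\<not> isomorphism scale D_inf_mountain V W f"
  shows "(rep_measure W, rep_measure V) \<in> rep_order"
proof -
  have V: "quiver_rep scale D_inf_mountain V" and W: "quiver_rep scale D_inf_mountain W"
    using VF WF by (auto simp: flei_indecomposables_def)
  have V_cases: "(\<exists>w x. simple_at_leaf V w \<and> x \<noteq> 0 \<and> vspace V w = span {x}) \<or> (\<exists>n. root_at V n)"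
    and W_cases: "(\<exists>w x. simple_at_leaf W w \<and> x \<noteq> 0 \<and> vspace W w = span {x}) \<or> (\<exists>n. root_at W n)"
    using VF WF indecomposable_cases by (auto simp: flei_indecomposables_def)
  have f: "morphism scale D_inf_mountain V W f"
    using nonzero by (simp add: nonzero_morphism_def)
  then have lin: "linear_between scale (vspace V i) (vspace W i) (f i)" for i
    by (simp add: morphism_def)
  obtain i y where iy: "y \<in> vspace V i" "f i y \<noteq> 0"
    using nonzero by (auto simp: nonzero_morphism_def)
  have f0: "f i 0 = 0" for i by (rule linear_between_0[OF lin rep_subspace[OF V]])
  from V_cases show ?thesis
  proof (elim disjE exE conjE)
    fix w x assume Vw: "simple_at_leaf V w" "x \<noteq> 0" "vspace V w = span {x}"
    from W_cases show ?thesis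
    proof (elim disjE exE conjE)
      fix w' x' assume Ww': "simple_at_leaf W w'" "x' \<noteq> 0" "vspace W w' = span {x'}"
      have "i = w" using iy f0 Vw(1) by (auto simp: simple_at_leaf_def)
      moreover have "i = w'"
        using iy linear_betweenD(1)[OF lin iy(1)] Ww'(1) by (auto simp: simple_at_leaf_def)
      ultimately have "w' = w" by simp
      have "bij_betw (f j) (vspace V j) (vspace W j)" for j
      proof (cases "j = w")
        case True
        then show ?thesis
          using bij_between_lines[of x x' "f w" y] lin[of w] iy Vw(3) Ww'(3) \<open>i = w\<close> \<open>w' = w\<close> by simp
      next
        case False
        then have "vspace V j = {0}" "vspace W j = {0}"
          using Vw(1) Ww'(1) \<open>w' = w\<close> by (auto simp: simple_at_leaf_def)
        then show ?thesis using f0 by (simp add: bij_betw_def)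
      qed
      then show ?thesis using not_iso f by (simp add: isomorphism_def)
    next
      fix m assume "root_at W m"
      then show ?thesis
        using start_simple_at_leaf[OF Vw(1)] start_root_at by (simp add: rep_measure_def rep_order_def)
    qed
  next
    fix n assume nV: "root_at V n"
    obtain z where z: "z \<in> vspace V (Vn n)" "f (Vn n) z \<noteq> 0"
      using morphism_determined_at_root[OF f V W nV _ iy(1)] iy(2) by blast
    then have Wn: "vspace W (Vn n) \<noteq> {0}" using linear_betweenD(1)[OF lin z(1)] by auto
    from W_cases show ?thesis
    proof (elim disjE exE conjE)
      fix w' x' assume "simple_at_leaf W w'"
      then show ?thesis using Wn by (auto simp: simple_at_leaf_def)
    next
      fix m assume mW: "root_at W m"
      then have "m \<le> n" using Wn unfolding root_at_def zero_before_def by (meson not_le)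
      show ?thesis
      proof (cases "m = n")
        case False
        then show ?thesis
          using \<open>m \<le> n\<close> start_root_at[OF mW] start_root_at[OF nV] by (simp add: rep_measure_def rep_order_def)
      next
        case True
        then have nW: "root_at W n" using mW by simp
        have data: "root_data (vertex_data V n)" "root_data (vertex_data W n)"
          using nV nW by (simp_all add: root_at_def)
        have "\<exists>y\<in>space (vertex_data V n). f (Vn n) y \<noteq> 0" using z by (auto simp: vertex_data_def)
        from data_measure_decreases[OF data morphism_data_map[OF f V] this] show ?thesis
        proof
          assume "(data_measure (vertex_data W n), data_measure (vertex_data V n)) \<in> measure_order"
          then show ?thesis
            using start_root_at[OF nW] start_root_at[OF nV] by (simp add: rep_measure_def rep_order_def)
        next
          assume "data_iso (vertex_data V n) (vertex_data W n) (f (Vn n))"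
          then have "isomorphism scale D_inf_mountain V W f"
            by (rule isomorphism_at_root[OF f V W nV nW])
          then show ?thesis using not_iso by simp
        qed
      qed
    qed
  qed
qed

section \<open>The order on isomorphism classes\<close>

text \<open>
Pairs are written with the target first, so that \<open>wf\<close> forbids infinite chains of morphisms.
\<close>
definition strict_arrow :: "('q, 'e) pre_digraph \<Rightarrow> ('q, 'e, 'v) rep rel" where
  "strict_arrow Q = {(W, V). V \<in> flei_indecomposables scale Q \<and> W \<in> flei_indecomposables scale Q \<and>
     (\<exists>f. nonzero_morphism scale Q V W f \<and> \<not> isomorphism scale Q V W f)}"

definition class_arrow :: "('q, 'e) pre_digraph \<Rightarrow> ('q, 'e, 'v) rep set rel" where
  "class_arrow Q = {(\<beta>, \<alpha>). \<alpha> \<in> indec_flei scale Q \<and> \<beta> \<in> indec_flei scale Q \<and>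
     (\<exists>V\<in>\<alpha>. \<exists>W\<in>\<beta>. (W, V) \<in> strict_arrow Q)}"

lemma morphism_comp:
  assumes f: "morphism scale Q V W f" and g: "morphism scale Q W X g" and Q: "wf_digraph Q"
  shows "morphism scale Q V X (\<lambda>i. g i \<circ> f i)"
proof -
  interpret wf_digraph Q by (rule Q)
  have fl: "linear_between scale (vspace V i) (vspace W i) (f i)"
    and gl: "linear_between scale (vspace W i) (vspace X i) (g i)" if "i \<in> verts Q" for i
    using f g that by (auto simp: morphism_def)
  have "linear_between scale (vspace V i) (vspace X i) (g i \<circ> f i)" if i: "i \<in> verts Q" for i
    using linear_betweenD[OF fl[OF i]] linear_betweenD[OF gl[OF i]] by (auto simp: linear_between_def)
  moreover have "g (head Q a) (f (head Q a) (vmap V a x)) = vmap X a (g (tail Q a) (f (tail Q a) x))"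
    if a: "a \<in> arcs Q" and x: "x \<in> vspace V (tail Q a)" for a x
  proof -
    have "f (tail Q a) x \<in> vspace W (tail Q a)" using linear_betweenD(1)[OF fl x] a by simp
    then show ?thesis using f g a x by (simp add: morphism_def)
  qed
  ultimately show ?thesis by (simp add: morphism_def)
qed

lemma isomorphism_id: "isomorphism scale Q V V (\<lambda>i. id)"
  by (auto simp: isomorphism_def morphism_def linear_between_def)

lemma isomorphism_comp:
  assumes "isomorphism scale Q V W f" "isomorphism scale Q W X g" "wf_digraph Q"
  shows "isomorphism scale Q V X (\<lambda>i. g i \<circ> f i)"
  using assms morphism_comp[of Q V W f X g] bij_betw_trans unfolding isomorphism_def by blast

lemma isomorphism_inv:
  assumes V: "quiver_rep scale Q V" and f: "isomorphism scale Q V W f" and Q: "wf_digraph Q"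
  shows "isomorphism scale Q W V (\<lambda>i. inv_into (vspace V i) (f i))"
proof -
  interpret wf_digraph Q by (rule Q)
  let ?g = "\<lambda>i. inv_into (vspace V i) (f i)"
  have sub: "subspace (vspace V i)" and lin: "linear_between scale (vspace V i) (vspace W i) (f i)"
    and bij: "bij_betw (f i) (vspace V i) (vspace W i)" if "i \<in> verts Q" for i
    using V f that by (auto simp: isomorphism_def morphism_def quiver_rep_def)
  have gV: "?g i y \<in> vspace V i" and fg: "f i (?g i y) = y" if "i \<in> verts Q" "y \<in> vspace W i" for i y
    using bij[OF that(1)] that(2) by (auto simp: bij_betw_def inv_into_into f_inv_into_f)
  have gf: "?g i (f i x) = x" if "i \<in> verts Q" "x \<in> vspace V i" for i x
    using bij[OF that(1)] that(2) by (simp add: bij_betw_def)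
  have "linear_between scale (vspace W i) (vspace V i) (?g i)" if i: "i \<in> verts Q" for i
    unfolding linear_between_def
  proof (intro conjI ballI allI)
    show "?g i ` vspace W i \<subseteq> vspace V i" using gV[OF i] by blast
  next
    fix x y assume xy: "x \<in> vspace W i" "y \<in> vspace W i"
    have "f i (?g i x + ?g i y) = x + y"
      using linear_betweenD(2)[OF lin[OF i]] gV[OF i] fg[OF i] xy by simp
    then show "?g i (x + y) = ?g i x + ?g i y"
      using gf[OF i, of "?g i x + ?g i y"] gV[OF i] xy subspace_add[OF sub[OF i]] by simp
  next
    fix c x assume x: "x \<in> vspace W i"
    have "f i (c *s ?g i x) = c *s x"
      using linear_betweenD(3)[OF lin[OF i]] gV[OF i] fg[OF i] x by simp
    then show "?g i (c *s x) = c *s ?g i x"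
      using gf[OF i, of "c *s ?g i x"] gV[OF i] x subspace_scale[OF sub[OF i]] by simp
  qed
  moreover have "?g (head Q a) (vmap W a x) = vmap V a (?g (tail Q a) x)"
    if a: "a \<in> arcs Q" and x: "x \<in> vspace W (tail Q a)" for a x
  proof -
    let ?y = "?g (tail Q a) x"
    have y: "?y \<in> vspace V (tail Q a)" using gV[of "tail Q a"] a x by simp
    then have "f (head Q a) (vmap V a ?y) = vmap W a (f (tail Q a) ?y)"
      using f a by (simp add: isomorphism_def morphism_def)
    moreover have "f (tail Q a) ?y = x" using fg a x by simp
    moreover have "vmap V a ?y \<in> vspace V (head Q a)"
      using V a y linear_betweenD(1) unfolding quiver_rep_def by blast
    ultimately show ?thesis using gf[of "head Q a" "vmap V a ?y"] a by simp
  qed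
  ultimately show ?thesis
    using bij_betw_inv_into[OF bij] by (auto simp: isomorphism_def morphism_def)
qed

lemma equiv_iso_rel:
  assumes "wf_digraph Q"
  shows "equiv (flei_indecomposables scale Q) (iso_rel scale Q)"
proof (rule equivI)
  show "refl_on (flei_indecomposables scale Q) (iso_rel scale Q)"
    using isomorphism_id by (auto simp: refl_on_def iso_rel_def)
  show "sym (iso_rel scale Q)"
    using isomorphism_inv[OF _ _ assms] by (fastforce simp: sym_def iso_rel_def flei_indecomposables_def)
  show "trans (iso_rel scale Q)"
    using isomorphism_comp[OF _ _ assms] unfolding trans_def iso_rel_def by blast
qed (auto simp: iso_rel_def)

lemma strict_arrow_iso_invariant:
  assumes Q: "wf_digraph Q" and arrow: "(W, V) \<in> strict_arrow Q"
    and VV': "(V', V) \<in> iso_rel scale Q" and WW': "(W, W') \<in> iso_rel scale Q"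
  shows "(W', V') \<in> strict_arrow Q"
proof -
  obtain f where f: "nonzero_morphism scale Q V W f" "\<not> isomorphism scale Q V W f"
    using arrow by (auto simp: strict_arrow_def)
  obtain h k where h: "isomorphism scale Q V' V h" and k: "isomorphism scale Q W W' k"
    using VV' WW' by (auto simp: iso_rel_def)
  define F where "F = (\<lambda>i. k i \<circ> (f i \<circ> h i))"
  have fm: "morphism scale Q V W f" using f by (simp add: nonzero_morphism_def)
  have "morphism scale Q V' W (\<lambda>i. f i \<circ> h i)"
    using morphism_comp[OF _ fm Q] h by (simp add: isomorphism_def)
  then have F: "morphism scale Q V' W' F"
    using morphism_comp[OF _ _ Q] k unfolding F_def isomorphism_def by blast
  have hb: "bij_betw (h i) (vspace V' i) (vspace V i)" and kb: "bij_betw (k i) (vspace W i) (vspace W' i)"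
    and flin: "linear_between scale (vspace V i) (vspace W i) (f i)" if "i \<in> verts Q" for i
    using h k fm that by (auto simp: isomorphism_def morphism_def)
  have "\<exists>i\<in>verts Q. \<exists>x\<in>vspace V' i. F i x \<noteq> 0"
  proof -
    obtain i x where i: "i \<in> verts Q" and x: "x \<in> vspace V i" "f i x \<noteq> 0"
      using f by (auto simp: nonzero_morphism_def)
    obtain x' where x': "x' \<in> vspace V' i" "h i x' = x"
      using hb[OF i] x by (metis bij_betw_def imageE)
    have "subspace (vspace W i)"
      using WW' i by (auto simp: iso_rel_def flei_indecomposables_def quiver_rep_def)
    then have "k i 0 = 0" "0 \<in> vspace W i"
      using linear_between_0[of "vspace W i" "vspace W' i" "k i"] k i subspace_0
      by (auto simp: isomorphism_def morphism_def)
    then have "k i (f i x) \<noteq> 0"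
      using kb[OF i] linear_betweenD(1)[OF flin[OF i] x(1)] x(2) by (metis bij_betw_def inj_onD)
    then show ?thesis using i x' by (auto simp: F_def)
  qed
  moreover have "\<not> isomorphism scale Q V' W' F"
  proof
    assume iso: "isomorphism scale Q V' W' F"
    have "bij_betw (f i) (vspace V i) (vspace W i)" if i: "i \<in> verts Q" for i
    proof -
      have "bij_betw (k i \<circ> (f i \<circ> h i)) (vspace V' i) (vspace W' i)"
        using iso i by (simp add: isomorphism_def F_def)
      moreover have "(f i \<circ> h i) ` vspace V' i \<subseteq> vspace W i"
        using hb[OF i] linear_betweenD(1)[OF flin[OF i]] by (auto simp: bij_betw_def)
      ultimately have "bij_betw (f i \<circ> h i) (vspace V' i) (vspace W i)"
        using bij_betw_comp_iff2[OF kb[OF i]] by blast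
      then show ?thesis using bij_betw_comp_iff[OF hb[OF i]] by blast
    qed
    then show False using f(2) fm by (simp add: isomorphism_def)
  qed
  ultimately show ?thesis
    using F VV' WW' unfolding strict_arrow_def iso_rel_def nonzero_morphism_def by blast
qed

text \<open>
In a chain of morphisms, the target of each step and the source of the next one have to be the same
representation. As the existence of a nonzero non-isomorphism is invariant under isomorphism, one
representative for each class suffices.
\<close>
lemma class_representatives:
  fixes Q :: "('q, 'e) pre_digraph"
  assumes Q: "wf_digraph Q"
  obtains rep where "\<And>\<alpha>. \<alpha> \<in> indec_flei scale Q \<Longrightarrow> rep \<alpha> \<in> \<alpha>"
    "\<And>\<alpha> \<beta>. (\<beta>, \<alpha>) \<in> class_arrow Q \<Longrightarrow> (rep \<beta>, rep \<alpha>) \<in> strict_arrow Q"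
proof -
  note eq = equiv_iso_rel[OF Q]
  define rep :: "('q, 'e, 'v) rep set \<Rightarrow> ('q, 'e, 'v) rep" where "rep = (\<lambda>\<alpha>. SOME V. V \<in> \<alpha>)"
  have rep: "rep \<alpha> \<in> \<alpha>" if "\<alpha> \<in> indec_flei scale Q" for \<alpha>
    using in_quotient_imp_non_empty[OF eq] that unfolding indec_flei_def rep_def by (simp add: some_in_eq)
  have "(rep \<beta>, rep \<alpha>) \<in> strict_arrow Q" if arrow: "(\<beta>, \<alpha>) \<in> class_arrow Q" for \<alpha> \<beta>
  proof -
    obtain V W where VW: "\<alpha> \<in> indec_flei scale Q" "\<beta> \<in> indec_flei scale Q" "V \<in> \<alpha>" "W \<in> \<beta>"
      "(W, V) \<in> strict_arrow Q"
      using arrow by (auto simp: class_arrow_def)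
    have "(rep \<alpha>, V) \<in> iso_rel scale Q" "(W, rep \<beta>) \<in> iso_rel scale Q"
      using quotient_eq_iff[OF eq] VW rep unfolding indec_flei_def by blast+
    then show ?thesis using strict_arrow_iso_invariant[OF Q VW(5)] by blast
  qed
  with rep show thesis using that by blast
qed

lemma indec_le_iff:
  assumes Q: "wf_digraph Q"
  shows "indec_le scale Q \<beta> \<alpha> \<longleftrightarrow>
    \<alpha> \<in> indec_flei scale Q \<and> \<beta> \<in> indec_flei scale Q \<and> (\<beta>, \<alpha>) \<in> (class_arrow Q)\<^sup>*"
proof
  assume "indec_le scale Q \<beta> \<alpha>"
  then obtain n \<gamma> W f where n: "n \<ge> (1::nat)" and ends: "\<gamma> 1 = \<alpha>" "\<gamma> n = \<beta>"
    and mem: "\<And>i. i \<in> {1..n} \<Longrightarrow> \<gamma> i \<in> indec_flei scale Q \<and> W i \<in> \<gamma> i"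
    and mor: "\<And>i. i \<in> {1..<n} \<Longrightarrow> nonzero_morphism scale Q (W i) (W (Suc i)) (f i) \<and>
       \<not> isomorphism scale Q (W i) (W (Suc i)) (f i)"
    unfolding indec_le_def by blast
  have W: "W i \<in> flei_indecomposables scale Q" if "i \<in> {1..n}" for i
    using mem[OF that] in_quotient_imp_subset[OF equiv_iso_rel[OF Q]] unfolding indec_flei_def by blast
  have "Suc i \<le> n \<Longrightarrow> (\<gamma> (Suc i), \<alpha>) \<in> (class_arrow Q)\<^sup>*" for i
  proof (induction i)
    case (Suc i)
    have i: "Suc i \<in> {1..n}" "Suc (Suc i) \<in> {1..n}" "Suc i \<in> {1..<n}" using Suc by auto
    have "(W (Suc (Suc i)), W (Suc i)) \<in> strict_arrow Q"
      unfolding strict_arrow_def using W[OF i(1)] W[OF i(2)] mor[OF i(3)] by blast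
    then have "(\<gamma> (Suc (Suc i)), \<gamma> (Suc i)) \<in> class_arrow Q"
      unfolding class_arrow_def using mem[OF i(1)] mem[OF i(2)] by blast
    with Suc show ?case by (meson Suc_leD converse_rtrancl_into_rtrancl)
  qed (use ends in simp)
  from this[of "n - 1"] show "\<alpha> \<in> indec_flei scale Q \<and> \<beta> \<in> indec_flei scale Q \<and> (\<beta>, \<alpha>) \<in> (class_arrow Q)\<^sup>*"
    using n ends mem[of 1] mem[of n] by simp
next
  assume *: "\<alpha> \<in> indec_flei scale Q \<and> \<beta> \<in> indec_flei scale Q \<and> (\<beta>, \<alpha>) \<in> (class_arrow Q)\<^sup>*"
  obtain rep where rep: "\<And>\<alpha>. \<alpha> \<in> indec_flei scale Q \<Longrightarrow> rep \<alpha> \<in> \<alpha>"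
    "\<And>\<alpha> \<beta>. (\<beta>, \<alpha>) \<in> class_arrow Q \<Longrightarrow> (rep \<beta>, rep \<alpha>) \<in> strict_arrow Q"
    using class_representatives[OF Q] by blast
  obtain n where "(\<beta>, \<alpha>) \<in> class_arrow Q ^^ n" using * rtrancl_imp_relpow by blast
  then obtain g where g: "g 0 = \<beta>" "g n = \<alpha>" "\<And>i. i < n \<Longrightarrow> (g i, g (Suc i)) \<in> class_arrow Q"
    unfolding relpow_fun_conv by blast
  \<comment> \<open>The path \<open>g\<close> runs upwards from \<open>\<beta>\<close> and starts at index 0; the chain runs downwards from index 1.\<close>
  define \<gamma> where "\<gamma> = (\<lambda>i. g (Suc n - i))"
  have step: "(\<gamma> (Suc i), \<gamma> i) \<in> class_arrow Q" if "i \<in> {1..<Suc n}" for i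
    using g(3)[of "n - i"] that by (simp add: \<gamma>_def Suc_diff_le)
  have mem: "\<gamma> i \<in> indec_flei scale Q" if "i \<in> {1..Suc n}" for i
  proof (cases "i = 1")
    case True
    then show ?thesis using * g by (simp add: \<gamma>_def)
  next
    case False
    then have "i - 1 \<in> {1..<Suc n}" "Suc (i - 1) = i" using that by auto
    then show ?thesis using step[of "i - 1"] by (auto simp: class_arrow_def)
  qed
  have "\<exists>f. nonzero_morphism scale Q (rep (\<gamma> i)) (rep (\<gamma> (Suc i))) f \<and>
      \<not> isomorphism scale Q (rep (\<gamma> i)) (rep (\<gamma> (Suc i))) f" if "i \<in> {1..<Suc n}" for i
    using rep(2)[OF step[OF that]] by (auto simp: strict_arrow_def)
  then obtain f where "\<forall>i\<in>{1..<Suc n}. nonzero_morphism scale Q (rep (\<gamma> i)) (rep (\<gamma> (Suc i))) (f i) \<and>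
      \<not> isomorphism scale Q (rep (\<gamma> i)) (rep (\<gamma> (Suc i))) (f i)"
    using bchoice[of "{1..<Suc n}"] by (metis (no_types, lifting))
  moreover have "\<gamma> 1 = \<alpha>" "\<gamma> (Suc n) = \<beta>" using g by (simp_all add: \<gamma>_def)
  ultimately show "indec_le scale Q \<beta> \<alpha>"
    unfolding indec_le_def using mem rep(1)
    by (intro exI[of _ "Suc n"] exI[of _ \<gamma>] exI[of _ "\<lambda>i. rep (\<gamma> i)"] exI[of _ f]) auto
qed

text \<open>
A well-founded relation has no cycles, which gives antisymmetry of its reflexive transitive closure.
\<close>
lemma well_founded_partial_order:
  assumes Q: "wf_digraph Q" and wf: "wf (strict_arrow Q)"
  defines "I \<equiv> indec_flei scale Q"
  defines "R \<equiv> relation_of (indec_le scale Q) I"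
  shows "partial_order_on I R \<and> wf (R - Id)"
proof -
  let ?E = "class_arrow Q"
  have R: "R = (I \<times> I) \<inter> ?E\<^sup>*"
    unfolding R_def I_def relation_of_def using indec_le_iff[OF Q] by blast
  obtain rep where "\<And>\<alpha> \<beta>. (\<beta>, \<alpha>) \<in> ?E \<Longrightarrow> (rep \<beta>, rep \<alpha>) \<in> strict_arrow Q"
    by (rule class_representatives[OF Q]) blast
  then have "?E \<subseteq> inv_image (strict_arrow Q) rep" by auto
  then have wfE: "wf (?E\<^sup>+)"
    by (rule wf_trancl[OF wf_subset[OF wf_inv_image[OF wf]]])
  have R_trancl: "R - Id \<subseteq> ?E\<^sup>+" unfolding R by (auto simp: rtrancl_eq_or_trancl)
  have "antisym R"
  proof (rule antisymI)
    fix \<alpha> \<beta> assume *: "(\<alpha>, \<beta>) \<in> R" "(\<beta>, \<alpha>) \<in> R"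
    show "\<alpha> = \<beta>"
    proof (rule ccontr)
      assume "\<alpha> \<noteq> \<beta>"
      then have "(\<alpha>, \<beta>) \<in> ?E\<^sup>+" "(\<beta>, \<alpha>) \<in> ?E\<^sup>+" using * R_trancl by auto
      then show False using wf_not_sym[OF wfE] by blast
    qed
  qed
  moreover have "refl_on I R" "R \<subseteq> I \<times> I" "trans R"
    unfolding R by (auto simp: refl_on_def trans_def intro: rtrancl_trans)
  ultimately have "partial_order_on I R"
    by (simp add: partial_order_on_def preorder_on_def)
  moreover have "wf (R - Id)" using wfE R_trancl wf_subset by blast
  ultimately show ?thesis by blast
qed

end

theorem corollary4p2:
  fixes scale :: "'k::field \<Rightarrow> 'v::ab_group_add \<Rightarrow> 'v"
  assumes "vector_space scale"
  defines "I \<equiv> indec_flei scale D_inf_mountain"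
  defines "R \<equiv> relation_of (indec_le scale D_inf_mountain) I"
  shows "partial_order_on I R \<and> wf (R - Id)"
proof -
  interpret scaled_space scale using assms(1) by (simp add: scaled_space_def)
  have "strict_arrow D_inf_mountain \<subseteq> inv_image rep_order rep_measure"
    using rep_measure_decreases by (auto simp: strict_arrow_def)
  then have "wf (strict_arrow D_inf_mountain)"
    by (rule wf_subset[OF wf_inv_image[OF wf_rep_order]])
  then show ?thesis
    unfolding R_def I_def by (rule well_founded_partial_order[OF wf_mountain])
qed

end
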